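(* Let $\beta\in\mathcal{B}_2\setminus\mathcal{B}_1$ and let $\rho$ be a regularizing function for $\beta$ with associated deformed sequence $\beta(\Lambda)$ and singular part $r(\Lambda)$. Then the formal series $$\sum_{j=0}^{+\infty}\frac{(is)^j}{j!}\mathbb{H}(S_1^j)\quad\text{(in } s),\qquad \sum_{j=0}^{+\infty}\frac{(-\lambda)^j}{j!}\mathbb{H}(S_1^{2j})\quad\text{(in }\lambda)$$ are renormalizable, and the renormalization consists in passing, for $\theta\in\mathbb{R}$, to the formal series $$\sum_{j=0}^{+\infty}\frac{(is)^j}{j!}\mathbb{H}\big((S_1-r(\Lambda)/2-\theta/2)^j\big),\qquad \sum_{j=0}^{+\infty}\frac{(-\lambda)^j}{j!}\mathbb{H}\big((S_1-r(\Lambda)/2-\theta/2)^{2j}\big),$$ respectively (corresponding to replacing the exponents $isS_1$ and $-\lambda S_1^2$ by $is(S_1-r(\Lambda)/2-\theta/2)$ and $-\lambda(S_1-r(\Lambda)/2-\theta/2)^2$). In particular, every coefficient of each of the two latter series is finite for all sufficiently large $\Lambda$ and has a finite limit as $\Lambda\to+\infty$.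
   Context: For $k\in\mathbb{N}=\{1,2,\dots\}$, $\mathcal{B}_k$ is the set of real sequences $\beta=\{\beta_j\}_{j=1}^{+\infty}$ with $\beta_j>0$ for all $j$ and $b_k(\beta)=\sum_{j=1}^{+\infty}\beta_j^{-k}<+\infty$. Regularizing function: for $\beta\in\mathcal{B}_2\setminus\mathcal{B}_1$ it is a continuous function $\rho:[0,+\infty)\to[0,1]$ with $\rho(0)=1$ such that, putting $\beta_j(\Lambda)=\beta_j/\rho\big(\sqrt{\beta_j/\Lambda}\big)$ (with $1/\beta_j(\Lambda)=0$ if $\rho$ vanishes there) and $\beta(\Lambda)=\{\beta_j(\Lambda)\}_{j\ge1}$, for all $\Lambda$ larger than some fixed value one has $$\sum_{j=1}^{+\infty}\frac{1}{\beta_j(\Lambda)}=r(\Lambda)+\kappa+o(1)<+\infty\quad(\Lambda\to+\infty),$$ where $r(\Lambda)$ is a real function tending to $+\infty$ as $\Lambda\to+\infty$, and $\kappa\in\mathbb{R}$ does not depend on $\Lambda$. The operator $\mathbb{H}$ (depending on $\Lambda$): $S_1$ is regarded as an indeterminate, standing for a vertex with two external lines (diagram of $S_1[a]=\sum_j a_j^2$). $\mathbb{H}:\mathbb{C}[S_1]\to\mathbb{C}$ is the linear map with $\mathbb{H}(1)=1$ and, for $k\ge1$, $\mathbb{H}(S_1^k)$ equal to the sum over all perfect matchings (pairwise connections) of the $2k$ external lines of $k$ labelled vertices, where a line connecting indices $i,j$ has value $\delta_{ij}(2\beta_j(\Lambda))^{-1}$ and each vertex carries a summation over its index. Thus each matching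 decomposes the $k$ vertices into circles, a circle with $m$ vertices contributing $2^{-m}b_m(\beta(\Lambda))$, and the value of the matching is the product over its circles. E.g. $\mathbb{H}(S_1)=\tfrac12 b_1(\beta(\Lambda))$ and $\mathbb{H}(S_1^2)=\tfrac14b_1^2(\beta(\Lambda))+\tfrac12b_2(\beta(\Lambda))$. For an entire function $f(z)=\sum_jf_jz^j$, the regularized "physical" functional integral $\int_V\mathcal{D}a\,e^{-S_0[a,\beta(\Lambda)]}f(S_1[a])$ is by definition the formal series $\sum_jf_j\mathbb{H}(S_1^j)$; here $S_0[a,\beta]=\sum_j\beta_ja_j^2$. The two series in the claim are these integrals for $f(z)=e^{isz}$ and $f(z)=e^{-\lambda z^2}$. Renormalizable: such a formal series in the parameter $s$ (respectively $\lambda$) is called renormalizable if, by multiplying by a common factor $e^{h_1+ih_2}$ and shifting the parameter $s$ (resp. $\lambda$) by $h_3$ and $\beta_j(\Lambda)$ by $h_{3+j}$, one obtains a formal series in the parameter each of whose individual coefficients has a finite limit as $\Lambda\to+\infty$. Here a shift $\beta_j(\Lambda)\to\beta_j(\Lambda)+\alpha_j$ is understood as adding the term $-\sum_j\alpha_ja_j^2$ in the exponent (for constant $\alpha_j=\alpha$, the additional vertex $-\alpha S_1$). The $h_i$ are real functions of $\Lambda$, the parameter and $\beta$, and those that are not identically zero must diverge as $\Lambda\to+\infty$ for each fixed nonzero value of the parameter and tend to $0$ as the parameter tends to $0$ for each fixed $\Lambda$. *)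

theory Defs
  imports "HOL-Analysis.Analysis" "HOL-Library.Disjoint_Sets" "HOL-Library.FuncSet"
    "HOL-Computational_Algebra.Computational_Algebra"
begin

text \<open>Sequences are indexed from 0: \<open>\<beta> j\<close> stands for \<open>\<beta>\<^sub>j\<^sub>+\<^sub>1\<close>.\<close>

definition seq_class :: "nat \<Rightarrow> (nat \<Rightarrow> real) set" where
  "seq_class k = {\<beta>. (\<forall>j. \<beta> j > 0) \<and> summable (\<lambda>j. 1 / \<beta> j ^ k)}"

text \<open>Where \<open>\<rho>\<close> vanishes, division by zero makes the deformed term 0 and hence its
  reciprocal 0, which is the intended value of the reciprocal. Only reciprocals are used below.\<close>

definition deformed :: "(nat \<Rightarrow> real) \<Rightarrow> (real \<Rightarrow> real) \<Rightarrow> real \<Rightarrow> nat \<Rightarrow> real" where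
  "deformed \<beta> \<rho> \<Lambda> j = \<beta> j / \<rho> (sqrt (\<beta> j / \<Lambda>))"

definition regularizing ::
  "(nat \<Rightarrow> real) \<Rightarrow> (real \<Rightarrow> real) \<Rightarrow> (real \<Rightarrow> real) \<Rightarrow> real \<Rightarrow> bool" where
  "regularizing \<beta> \<rho> r \<kappa> \<longleftrightarrow>
     continuous_on {0..} \<rho> \<and> (\<forall>x\<ge>0. 0 \<le> \<rho> x \<and> \<rho> x \<le> 1) \<and> \<rho> 0 = 1 \<and>
     (\<exists>\<Lambda>\<^sub>0>0. \<forall>\<Lambda>>\<Lambda>\<^sub>0. summable (\<lambda>j. 1 / deformed \<beta> \<rho> \<Lambda> j)) \<and>
     filterlim r at_top at_top \<and>
     ((\<lambda>\<Lambda>. (\<Sum>j. 1 / deformed \<beta> \<rho> \<Lambda> j) - (r \<Lambda> + \<kappa>)) \<longlongrightarrow> 0) at_top"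

text \<open>Wick contractions. A vertex with weight \<open>w\<close> stands for the quadratic functional
  \<open>\<Sum>j. w j * a\<^sub>j\<^sup>2\<close>; \<open>S\<^sub>1\<close> is the vertex of weight 1. Among the \<open>2 * k\<close> external lines of the
  vertices \<open>0, \<dots>, k - 1\<close>, the lines \<open>2 * v\<close> and \<open>2 * v + 1\<close> belong to vertex \<open>v\<close>, so
  line \<open>l\<close> belongs to vertex \<open>l div 2\<close>. An index assignment \<open>\<iota>\<close> gives an index to each vertex.\<close>

definition line_matchings :: "nat \<Rightarrow> nat set set set" where
  "line_matchings k = {M. partition_on {..<2 * k} M \<and> (\<forall>e\<in>M. card e = 2)}"

definition propagator :: "(nat \<Rightarrow> real) \<Rightarrow> nat \<Rightarrow> nat \<Rightarrow> real" where
  "propagator b i j = (if i = j then 1 / (2 * b j) else 0)"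

definition diagram_term ::
  "(nat \<Rightarrow> real) \<Rightarrow> (nat \<Rightarrow> real) list \<Rightarrow> nat set set \<Rightarrow> (nat \<Rightarrow> nat) \<Rightarrow> real" where
  "diagram_term b ws M \<iota> =
     (\<Prod>v<length ws. (ws ! v) (\<iota> v)) *
     (\<Prod>e\<in>M. propagator b (\<iota> (Min e div 2)) (\<iota> (Max e div 2)))"

definition wick :: "(nat \<Rightarrow> real) \<Rightarrow> (nat \<Rightarrow> real) list \<Rightarrow> real" where
  "wick b ws = (\<Sum>M\<in>line_matchings (length ws).
     \<Sum>\<^sub>\<infinity>\<iota>\<in>{..<length ws} \<rightarrow>\<^sub>E UNIV. diagram_term b ws M \<iota>)"

definition wick_finite :: "(nat \<Rightarrow> real) \<Rightarrow> (nat \<Rightarrow> real) list \<Rightarrow> bool" where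
  "wick_finite b ws \<longleftrightarrow> (\<forall>M\<in>line_matchings (length ws).
     diagram_term b ws M summable_on ({..<length ws} \<rightarrow>\<^sub>E UNIV))"

text \<open>The contraction of \<open>Q(S\<^sub>1)\<close> times the product of the vertices \<open>ws\<close>, linear in \<open>Q\<close>.
  An infinite value shows up as failure of the accompanying finiteness predicate,
  since a divergent sum has the default value 0.\<close>

definition wick_poly :: "(nat \<Rightarrow> real) \<Rightarrow> complex poly \<Rightarrow> (nat \<Rightarrow> real) list \<Rightarrow> complex" where
  "wick_poly b Q ws =
     (\<Sum>k\<le>degree Q. coeff Q k * complex_of_real (wick b (replicate k (\<lambda>_. 1) @ ws)))"

definition wick_poly_finite ::
  "(nat \<Rightarrow> real) \<Rightarrow> complex poly \<Rightarrow> (nat \<Rightarrow> real) list \<Rightarrow> bool" where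
  "wick_poly_finite b Q ws \<longleftrightarrow>
     (\<forall>k. coeff Q k \<noteq> 0 \<longrightarrow> wick_finite b (replicate k (\<lambda>_. 1) @ ws))"

definition H :: "(nat \<Rightarrow> real) \<Rightarrow> complex poly \<Rightarrow> complex" where
  "H b Q = wick_poly b Q []"

definition H_finite :: "(nat \<Rightarrow> real) \<Rightarrow> complex poly \<Rightarrow> bool" where
  "H_finite b Q \<longleftrightarrow> wick_poly_finite b Q []"

abbreviation S1 :: "complex poly" where
  "S1 \<equiv> [:0, 1:]"

text \<open>The formal series, in the parameter \<open>t\<close>, of the integral of \<open>exp (t * P(S\<^sub>1))\<close>.\<close>

definition exp_integral :: "(nat \<Rightarrow> real) \<Rightarrow> complex poly \<Rightarrow> complex fps" where
  "exp_integral b P = Abs_fps (\<lambda>j. H b (P ^ j) / fact j)"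

definition complex_fps :: "real fps \<Rightarrow> complex fps" where
  "complex_fps F = Abs_fps (\<lambda>n. complex_of_real (fps_nth F n))"

text \<open>Here \<open>g i\<close> is the expansion in \<open>t\<close> of \<open>h\<^sub>i\<close>, \<open>i \<ge> 1\<close>, with zero constant term;
  \<open>g (4 + j)\<close> belongs to the shift of \<open>b j\<close>. The series is the expansion in \<open>t\<close> of
    \<open>exp (h\<^sub>1 + \<i> * h\<^sub>2) * \<integral> exp ((t + h\<^sub>3) * P(S\<^sub>1) - V)\<close>,  \<open>V = (\<Sum>j. h\<^sub>4\<^sub>+\<^sub>j * a\<^sub>j\<^sup>2)\<close>,
  i.e. of \<open>exp (h\<^sub>1 + \<i> * h\<^sub>2)\<close> times the sum over \<open>p\<close>, \<open>q\<close> of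
    \<open>(t + h\<^sub>3) ^ p / p! * (-1) ^ q / q! * \<integral> P(S\<^sub>1) ^ p * V ^ q\<close>.
  The coefficient of \<open>t ^ m\<close> in \<open>V ^ q\<close> is the sum over the lists \<open>ms\<close> of length \<open>q\<close> and
  sum \<open>m\<close> of the products of the vertices whose weights are the coefficients of \<open>t ^ l\<close>,
  \<open>l \<in> ms\<close>, in \<open>V\<close>. As all constant terms vanish, only \<open>p \<le> n - m\<close> and \<open>q \<le> m\<close>
  contribute to the coefficient of \<open>t ^ n\<close>.\<close>

definition shift_vertices :: "(nat \<Rightarrow> real fps) \<Rightarrow> nat list \<Rightarrow> (nat \<Rightarrow> real) list" where
  "shift_vertices g ms = map (\<lambda>l j. fps_nth (g (4 + j)) l) ms"

definition shifted_integral ::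
  "(nat \<Rightarrow> real) \<Rightarrow> complex poly \<Rightarrow> (nat \<Rightarrow> real fps) \<Rightarrow> complex fps" where
  "shifted_integral b P g =
     (fps_exp 1 oo (complex_fps (g 1) + fps_const \<i> * complex_fps (g 2))) *
     Abs_fps (\<lambda>n. \<Sum>m\<le>n. \<Sum>p\<le>n - m. \<Sum>q\<le>m.
       fps_nth ((fps_X + complex_fps (g 3)) ^ p) (n - m) / fact p * ((-1) ^ q / fact q) *
       (\<Sum>ms\<in>natpermute m q. wick_poly b (P ^ p) (shift_vertices g ms)))"

definition shifted_integral_finite ::
  "(nat \<Rightarrow> real) \<Rightarrow> complex poly \<Rightarrow> (nat \<Rightarrow> real fps) \<Rightarrow> bool" where
  "shifted_integral_finite b P g \<longleftrightarrow>
     (\<forall>n. \<forall>m\<le>n. \<forall>p\<le>n - m. \<forall>q\<le>m. \<forall>ms\<in>natpermute m q.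
        wick_poly_finite b (P ^ p) (shift_vertices g ms))"

text \<open>Arguments of \<open>h i\<close>: first \<open>\<Lambda>\<close>, then the parameter. In order that a formal series in
  the parameter results, the \<open>h i \<Lambda>\<close> are required to have a power series expansion at 0.
  Divergence means divergence to infinity in absolute value.\<close>

definition counterterms ::
  "(nat \<Rightarrow> real \<Rightarrow> real \<Rightarrow> real) \<Rightarrow> (nat \<Rightarrow> real \<Rightarrow> real fps) \<Rightarrow> bool" where
  "counterterms h g \<longleftrightarrow> (\<forall>i\<ge>1.
     (\<forall>\<Lambda>. h i \<Lambda> has_fps_expansion g i \<Lambda>) \<and>
     ((\<forall>\<Lambda> t. h i \<Lambda> t = 0) \<or>
      (\<forall>t. t \<noteq> 0 \<longrightarrow> filterlim (\<lambda>\<Lambda>. h i \<Lambda> t) at_infinity at_top) \<and>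
      (\<forall>\<Lambda>. (h i \<Lambda> \<longlongrightarrow> 0) (at 0))))"

text \<open>\<open>F\<close> is a renormalization of the series \<open>F\<^sub>0\<close> of the integral of \<open>exp (t * P(S\<^sub>1))\<close>
  with regularized sequences \<open>b \<Lambda>\<close>; \<open>P\<close> is needed to make sense of the shift of \<open>b \<Lambda>\<close>.\<close>

definition renormalization ::
  "(real \<Rightarrow> nat \<Rightarrow> real) \<Rightarrow> complex poly \<Rightarrow> (real \<Rightarrow> complex fps) \<Rightarrow> (real \<Rightarrow> complex fps) \<Rightarrow> bool"
  where
  "renormalization b P F\<^sub>0 F \<longleftrightarrow>
     (\<forall>\<Lambda>. F\<^sub>0 \<Lambda> = exp_integral (b \<Lambda>) P) \<and>
     (\<exists>h g. counterterms h g \<and>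
        (\<forall>\<^sub>F \<Lambda> in at_top. shifted_integral_finite (b \<Lambda>) P (\<lambda>i. g i \<Lambda>) \<and>
                     F \<Lambda> = shifted_integral (b \<Lambda>) P (\<lambda>i. g i \<Lambda>))) \<and>
     (\<forall>n. \<exists>L. ((\<lambda>\<Lambda>. fps_nth (F \<Lambda>) n) \<longlongrightarrow> L) at_top)"

definition renormalizable ::
  "(real \<Rightarrow> nat \<Rightarrow> real) \<Rightarrow> complex poly \<Rightarrow> (real \<Rightarrow> complex fps) \<Rightarrow> bool" where
  "renormalizable b P F\<^sub>0 \<longleftrightarrow> (\<exists>F. renormalization b P F\<^sub>0 F)"

end

theory Submission
  imports Defs
begin

text \<open>Write \<open>c = r(\<Lambda>)/2 + \<theta>/2\<close>. The counterterms only replace \<open>\<i> s S\<^sub>1\<close> by \<open>\<i> s (S\<^sub>1 - c)\<close>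
  (take \<open>h\<^sub>2 = - s c\<close>) and \<open>- \<lambda> S\<^sub>1\<^sup>2\<close> by \<open>- \<lambda> (S\<^sub>1 - c)\<^sup>2\<close> (take \<open>h\<^sub>1 = - \<lambda> c\<^sup>2\<close> and the constant shift
  \<open>- 2 \<lambda> c\<close> of all \<open>\<beta>\<^sub>j(\<Lambda>)\<close>), so everything reduces to the convergence of the moments
  \<open>H((S\<^sub>1 - c)\<^sup>k)\<close>. Summing over the matchings for a fixed index assignment gives a product of double
  factorials, whence the exponential generating series of the moments of \<open>S\<^sub>1\<close> satisfies
  \<open>D' = D * (\<Sum>i. b\<^sub>i\<^sub>+\<^sub>1(\<beta>(\<Lambda>)) t\<^sup>i / 2)\<close>. Subtracting \<open>c\<close> from \<open>S\<^sub>1\<close> subtracts \<open>c\<close> from the constant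
  coefficient of the second factor, which then tends to \<open>(\<kappa> - \<theta>) / 2\<close>; the other coefficients
  converge by dominated convergence because \<open>\<beta>\<close> lies in the class of order 2.\<close>

section \<open>Counting matchings\<close>

text \<open>A line will be coloured by the index of its vertex. The matchings with monochromatic
  edges are then those in which no Kronecker delta of a propagator vanishes.\<close>

definition color_matchings :: "('a \<Rightarrow> 'c) \<Rightarrow> 'a set \<Rightarrow> 'a set set set" where
  "color_matchings f L =
     {M. partition_on L M \<and> (\<forall>e\<in>M. card e = 2 \<and> (\<forall>a\<in>e. \<forall>b\<in>e. f a = f b))}"

text \<open>The number of perfect matchings of an \<open>n\<close>-element set:
  \<open>(n - 1)!!\<close> for even \<open>n\<close> and 0 for odd \<open>n\<close>, found by
  choosing the partner of one element.\<close>

fun pairings :: "nat \<Rightarrow> nat" where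
  "pairings 0 = 1"
| "pairings (Suc 0) = 0"
| "pairings (Suc (Suc n)) = Suc n * pairings n"

lemma finite_color_matchings: "finite L \<Longrightarrow> finite (color_matchings f L)"
  by (rule finite_subset[OF _ finitely_many_partition_on]) (auto simp: color_matchings_def)

lemma color_matchings_insert_pair:
  assumes "l \<in> L" "l' \<in> L - {l}" "f l' = f l" "M \<in> color_matchings f (L - {l, l'})"
  shows "insert {l, l'} M \<in> color_matchings f L"
proof -
  have "partition_on (L - {l, l'}) M"
    using assms(4) by (simp add: color_matchings_def)
  moreover from this have "disjnt {l, l'} (\<Union>M)"
    by (auto simp: partition_on_def disjnt_def)
  ultimately have "partition_on L (insert {l, l'} M)"
    using assms(1,2) by (simp add: partition_on_insert)
  moreover have "card {l, l'} = 2 \<and> (\<forall>a\<in>{l, l'}. \<forall>b\<in>{l, l'}. f a = f b)"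
    using assms(2,3) by auto
  ultimately show ?thesis
    using assms(4) unfolding color_matchings_def by blast
qed

lemma color_matchings_remove_pair:
  assumes M: "M \<in> color_matchings f L" and l: "l \<in> L"
  obtains l' where "l' \<in> L - {l}" "f l' = f l" "{l, l'} \<in> M"
    "M - {{l, l'}} \<in> color_matchings f (L - {l, l'})"
proof -
  have p: "partition_on L M" and c: "\<And>e. e \<in> M \<Longrightarrow> card e = 2"
    and m: "\<And>e a b. e \<in> M \<Longrightarrow> a \<in> e \<Longrightarrow> b \<in> e \<Longrightarrow> f a = f b"
    using M unfolding color_matchings_def by blast+
  from p l obtain e where e: "e \<in> M" "l \<in> e"
    by (auto simp: partition_on_def)
  from c[OF e(1)] e(2) obtain l' where l': "e = {l, l'}" "l' \<noteq> l"
    by (auto simp: card_2_iff)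
  have "\<Union>(M - {e}) = L - e"
    using p e(1) by (fastforce simp: partition_on_def disjoint_def)
  then have "partition_on (L - e) (M - {e})"
    using p by (auto simp: partition_on_def disjoint_def)
  then have "M - {{l, l'}} \<in> color_matchings f (L - {l, l'})"
    using M l' unfolding color_matchings_def by blast
  moreover have "l' \<in> L"
    using p e l' by (auto simp: partition_on_def)
  ultimately show ?thesis
    using that[of l'] l' e m[OF e(1), of l' l] by auto
qed

text \<open>Sorts the matchings by the partner \<open>l'\<close> of \<open>l\<close>, which must
  have the same colour; the other edges form a matching of what remains.\<close>

lemma color_matchings_rec:
  assumes "l \<in> L"
  shows "color_matchings f L =
    (\<Union>l'\<in>{l'\<in>L - {l}. f l' = f l}. insert {l, l'} ` color_matchings f (L - {l, l'}))"
proof (intro equalityI subsetI)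
  fix M assume "M \<in> color_matchings f L"
  then obtain l' where "l' \<in> L - {l}" "f l' = f l" "{l, l'} \<in> M"
    "M - {{l, l'}} \<in> color_matchings f (L - {l, l'})"
    using assms by (rule color_matchings_remove_pair)
  moreover from this have "M = insert {l, l'} (M - {{l, l'}})"
    by blast
  ultimately show "M \<in> (\<Union>l'\<in>{l'\<in>L - {l}. f l' = f l}.
      insert {l, l'} ` color_matchings f (L - {l, l'}))"
    by blast
next
  fix M assume "M \<in> (\<Union>l'\<in>{l'\<in>L - {l}. f l' = f l}.
      insert {l, l'} ` color_matchings f (L - {l, l'}))"
  then obtain l' M' where "l' \<in> L - {l}" "f l' = f l" "M = insert {l, l'} M'"
    "M' \<in> color_matchings f (L - {l, l'})"
    by blast
  then show "M \<in> color_matchings f L"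
    using color_matchings_insert_pair[OF assms] by simp
qed

text \<open>The union in the recursion is disjoint since \<open>l\<close> has only one partner, and
  adding \<open>{l, l'}\<close> is injective since no edge of the smaller matching meets it.\<close>

lemma card_color_matchings_rec:
  assumes "finite L" "l \<in> L"
  shows "card (color_matchings f L) =
    (\<Sum>l'\<in>{l'\<in>L - {l}. f l' = f l}. card (color_matchings f (L - {l, l'})))"
proof -
  let ?I = "{l'\<in>L - {l}. f l' = f l}"
  let ?A = "\<lambda>l'. insert {l, l'} ` color_matchings f (L - {l, l'})"
  have notin: "l \<notin> e \<and> l' \<notin> e" if "M \<in> color_matchings f (L - {l, l'})" "e \<in> M" for l' M e
    using that by (auto simp: color_matchings_def partition_on_def)
  have "?A l' \<inter> ?A l'' = {}" if "l' \<noteq> l''" for l' l''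
  proof -
    have "{l, l'} \<notin> insert {l, l''} M" if "M \<in> color_matchings f (L - {l, l''})" for M
      using notin[OF that] \<open>l' \<noteq> l''\<close> by (auto simp: doubleton_eq_iff)
    then show ?thesis
      by blast
  qed
  then have "card (color_matchings f L) = (\<Sum>l'\<in>?I. card (?A l'))"
    unfolding color_matchings_rec[OF assms(2)]
    using assms(1) by (intro card_UN_disjoint) (auto intro!: finite_color_matchings)
  also have "\<dots> = (\<Sum>l'\<in>?I. card (color_matchings f (L - {l, l'})))"
  proof (intro sum.cong refl card_image inj_onI)
    fix l' M M'
    assume M: "M \<in> color_matchings f (L - {l, l'})" "M' \<in> color_matchings f (L - {l, l'})"
      and eq: "insert {l, l'} M = insert {l, l'} M'"
    show "M = M'"
      using eq notin[OF M(1)] notin[OF M(2)] by (metis insertI1 insert_ident)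
  qed
  finally show ?thesis .
qed

text \<open>Odd colour classes are covered by \<open>pairings (Suc 0) = 0\<close>.\<close>

lemma card_color_matchings:
  assumes "finite L" "finite C" "f ` L \<subseteq> C"
  shows "card (color_matchings f L) = (\<Prod>c\<in>C. pairings (card {l\<in>L. f l = c}))"
  using assms
proof (induction "card L" arbitrary: L rule: less_induct)
  case less
  show ?case
  proof (cases "L = {}")
    case True
    then show ?thesis
      by (simp add: color_matchings_def partition_on_empty cong: conj_cong)
  next
    case False
    then obtain l where l: "l \<in> L" by blast
    \<comment> \<open>\<open>n\<close> counts the possible partners of \<open>l\<close>, so its
      colour class has \<open>Suc n\<close> elements and keeps \<open>n - 1\<close> once an edge is
      removed. \<open>R\<close> collects the other classes, which stay as they are.\<close>
    define n where "n = card {l'\<in>L - {l}. f l' = f l}"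
    define R where "R = (\<Prod>c\<in>C - {f l}. pairings (card {l\<in>L. f l = c}))"
    have cl: "card {l'\<in>L. f l' = f l} = Suc n"
    proof -
      have "{l'\<in>L. f l' = f l} = insert l {l'\<in>L - {l}. f l' = f l}"
        using l by auto
      then show ?thesis
        using less.prems by (simp add: n_def)
    qed
    have fl: "f l \<in> C"
      using l less.prems by auto
    have split: "(\<Prod>c\<in>C. g c) = g (f l) * (\<Prod>c\<in>C - {f l}. g c)" for g :: "'b \<Rightarrow> nat"
      using prod.remove[OF \<open>finite C\<close> fl] .
    have step: "card (color_matchings f (L - {l, l'})) = pairings (n - 1) * R"
      if l': "l' \<in> {l'\<in>L - {l}. f l' = f l}" for l'
    proof -
      have sub: "L - {l, l'} \<subset> L"
        using l by auto
      have "card {x \<in> L - {l, l'}. f x = f l} = n - 1"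
      proof -
        have "{x \<in> L - {l, l'}. f x = f l} = {x \<in> L - {l}. f x = f l} - {l'}"
          by auto
        then show ?thesis
          using l' less.prems by (simp add: n_def card_Diff_singleton)
      qed
      moreover have "{x \<in> L - {l, l'}. f x = c} = {x \<in> L. f x = c}" if "c \<noteq> f l" for c
        using that l' by auto
      moreover have "card (color_matchings f (L - {l, l'})) =
          (\<Prod>c\<in>C. pairings (card {x\<in>L - {l, l'}. f x = c}))"
        using less.prems sub by (intro less.hyps psubset_card_mono) auto
      ultimately show ?thesis
        by (simp add: split R_def)
    qed
    have "card (color_matchings f L) =
        (\<Sum>l'\<in>{l'\<in>L - {l}. f l' = f l}. pairings (n - 1) * R)"
      unfolding card_color_matchings_rec[OF less.prems(1) l] by (intro sum.cong refl step)
    also have "\<dots> = n * pairings (n - 1) * R"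
      by (simp add: n_def)
    \<comment> \<open>For \<open>n = 0\<close> the truncated \<open>n - 1\<close> is harmless: both
      sides are 0.\<close>
    also have "n * pairings (n - 1) = pairings (Suc n)"
      by (cases n) auto
    finally show ?thesis
      by (simp add: split R_def cl)
  qed
qed

section \<open>Matchings of the external lines that respect an index assignment\<close>

definition compatible :: "nat \<Rightarrow> (nat \<Rightarrow> nat) \<Rightarrow> nat set set set" where
  "compatible k \<iota> = color_matchings (\<lambda>l. \<iota> (l div 2)) {..<2 * k}"

lemma card_lines_of_color: "card {l\<in>{..<2 * k}. P (l div 2)} = 2 * card {v\<in>{..<k::nat}. P v}"
proof -
  have "{l\<in>{..<2 * k}. P (l div 2)} =
      (\<lambda>v. 2 * v) ` {v\<in>{..<k}. P v} \<union> (\<lambda>v. 2 * v + 1) ` {v\<in>{..<k}. P v}" (is "_ = ?A \<union> ?B")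
  proof (intro equalityI subsetI)
    fix l assume "l \<in> {l\<in>{..<2 * k}. P (l div 2)}"
    then have "l div 2 \<in> {v\<in>{..<k}. P v}" by auto
    moreover have "l = 2 * (l div 2) \<or> l = 2 * (l div 2) + 1" by linarith
    ultimately show "l \<in> ?A \<union> ?B" by blast
  qed auto
  moreover have "?A \<inter> ?B = {}" by (auto, presburger)
  ultimately show ?thesis
    by (simp add: card_Un_disjoint card_image inj_on_def)
qed

text \<open>Colour classes of lines are twice as large as those of vertices. \<open>C\<close> may
  contain further indices, which contribute the factor \<open>pairings 0 = 1\<close>.\<close>

lemma card_compatible:
  assumes "finite C" "\<iota> ` {..<k} \<subseteq> C"
  shows "card (compatible k \<iota>) = (\<Prod>c\<in>C. pairings (2 * card {v\<in>{..<k}. \<iota> v = c}))"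
  unfolding compatible_def
proof (subst card_color_matchings[where C = C])
  show "(\<lambda>l. \<iota> (l div 2)) ` {..<2 * k} \<subseteq> C"
    using assms(2) by auto
qed (use assms(1) in \<open>simp_all add: card_lines_of_color[where P = "\<lambda>v. \<iota> v = c" for c]
    del: lessThan_iff\<close>)

text \<open>With \<open>m\<close> earlier vertices of index \<open>j\<close>, the double factorial
  \<open>(2 * m - 1)!!\<close> becomes \<open>(2 * m + 1)!!\<close>. In diagrams, the new vertex
  closes on itself or enters one of \<open>m\<close> edges in two ways.\<close>

lemma card_compatible_Suc:
  "card (compatible (Suc k) (\<iota>(k := j))) =
     (1 + 2 * card {v\<in>{..<k}. \<iota> v = j}) * card (compatible k \<iota>)"
proof -
  \<comment> \<open>\<open>j\<close> is included even if no earlier vertex has this index, so that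
    both products run over the same set.\<close>
  let ?C = "insert j (\<iota> ` {..<k})"
  have other: "{v\<in>{..<Suc k}. (\<iota>(k := j)) v = c} = {v\<in>{..<k}. \<iota> v = c}" if "c \<noteq> j" for c
    using that by auto
  have "{v\<in>{..<Suc k}. (\<iota>(k := j)) v = j} = insert k {v\<in>{..<k}. \<iota> v = j}"
    by auto
  then have same: "card {v\<in>{..<Suc k}. (\<iota>(k := j)) v = j} = Suc (card {v\<in>{..<k}. \<iota> v = j})"
    by simp
  have "card (compatible (Suc k) (\<iota>(k := j))) =
      (\<Prod>c\<in>?C. pairings (2 * card {v\<in>{..<Suc k}. (\<iota>(k := j)) v = c}))"
    by (rule card_compatible) auto
  also have "\<dots> = pairings (2 * Suc (card {v\<in>{..<k}. \<iota> v = j})) *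
      (\<Prod>c\<in>?C - {j}. pairings (2 * card {v\<in>{..<k}. \<iota> v = c}))"
    using same other by (subst prod.remove[of _ j]) (auto intro!: arg_cong2[where f = "(*)"] prod.cong)
  also have "\<dots> = (1 + 2 * card {v\<in>{..<k}. \<iota> v = j}) *
      (\<Prod>c\<in>?C. pairings (2 * card {v\<in>{..<k}. \<iota> v = c}))"
    by (subst prod.remove[of ?C j]) (simp_all add: algebra_simps)
  also have "(\<Prod>c\<in>?C. pairings (2 * card {v\<in>{..<k}. \<iota> v = c})) = card (compatible k \<iota>)"
    by (rule card_compatible[symmetric]) auto
  finally show ?thesis .
qed

text \<open>The count depends only on how often each index occurs, which relabelling the vertices
  does not change.\<close>

lemma card_compatible_permute:
  assumes "\<sigma> permutes {..<k}"
  shows "card (compatible k (\<iota> \<circ> \<sigma>)) = card (compatible k \<iota>)"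
proof -
  have "card {v\<in>{..<k}. \<iota> (\<sigma> v) = c} = card {v\<in>{..<k}. \<iota> v = c}" for c
  proof -
    have "\<sigma> ` {v\<in>{..<k}. \<iota> (\<sigma> v) = c} = {v\<in>{..<k}. \<iota> v = c}"
    proof (intro equalityI subsetI)
      fix v assume v: "v \<in> {v\<in>{..<k}. \<iota> v = c}"
      then obtain u where "u < k" "v = \<sigma> u"
        using permutes_image[OF assms] by (metis (no_types, lifting) imageE lessThan_iff mem_Collect_eq)
      then show "v \<in> \<sigma> ` {v\<in>{..<k}. \<iota> (\<sigma> v) = c}"
        using v by auto
    qed (use permutes_in_image[OF assms] in auto)
    then show ?thesis
      using card_image[OF inj_on_subset[OF permutes_inj[OF assms] subset_UNIV]] by metis
  qed
  moreover have "(\<iota> \<circ> \<sigma>) ` {..<k} = \<iota> ` {..<k}"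
    using permutes_image[OF assms] by (metis image_comp)
  ultimately show ?thesis
    by (simp add: card_compatible[where C = "\<iota> ` {..<k}"])
qed

text \<open>An edge between different indices gives the factor 0. In a compatible matching each edge
  carries the common value of its two ends; as every vertex has two lines, it contributes its value
  exactly once.\<close>

lemma prod_propagators:
  assumes M: "M \<in> line_matchings k" and nonneg: "\<And>j. 0 \<le> b j"
  shows "(\<Prod>e\<in>M. propagator b (\<iota> (Min e div 2)) (\<iota> (Max e div 2))) =
    (if M \<in> compatible k \<iota> then \<Prod>v<k. 1 / (2 * b (\<iota> v)) else 0)"
proof -
  define x where "x l = 1 / (2 * b (\<iota> (l div 2)))" for l :: nat
  have p: "partition_on {..<2 * k} M" and card2: "\<And>e. e \<in> M \<Longrightarrow> card e = 2"
    using M by (auto simp: line_matchings_def)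
  have finM: "finite M"
    using finite_elements[OF _ p] by simp
  have edge: "\<exists>u v. e = {u, v} \<and> u < v \<and> Min e = u \<and> Max e = v" if "e \<in> M" for e
  proof -
    from card2[OF that] obtain u v where uv: "e = {u, v}" "u < v"
      by (metis card_2_iff insert_commute linorder_neqE_nat)
    then show ?thesis
      by (intro exI[of _ u] exI[of _ v]) simp
  qed
  have comp: "M \<in> compatible k \<iota> \<longleftrightarrow> (\<forall>e\<in>M. \<iota> (Min e div 2) = \<iota> (Max e div 2))"
  proof -
    have "(\<forall>a\<in>e. \<forall>c\<in>e. \<iota> (a div 2) = \<iota> (c div 2)) \<longleftrightarrow> \<iota> (Min e div 2) = \<iota> (Max e div 2)"
      if "e \<in> M" for e
      using edge[OF that] by (elim exE conjE) (simp, metis)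
    then show ?thesis
      using p card2 unfolding compatible_def color_matchings_def by simp
  qed
  show ?thesis
  proof (cases "M \<in> compatible k \<iota>")
    case False
    then obtain e where "e \<in> M" "\<iota> (Min e div 2) \<noteq> \<iota> (Max e div 2)"
      using comp by blast
    then have "(\<Prod>e\<in>M. propagator b (\<iota> (Min e div 2)) (\<iota> (Max e div 2))) = 0"
      using finM by (intro prod_zero) (auto simp: propagator_def)
    then show ?thesis
      using False by simp
  next
    case True
    have "(\<Prod>e\<in>M. propagator b (\<iota> (Min e div 2)) (\<iota> (Max e div 2))) = (\<Prod>e\<in>M. x (Min e))"
      using True comp by (intro prod.cong) (auto simp: propagator_def x_def)
    also have "\<dots> = (\<Prod>v<k. x (2 * v))"
    proof -
      \<comment> \<open>Squaring gives both ends of an edge their factor, so the product runs over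
        all lines and meets each vertex twice; nonnegativity allows the square to be undone.\<close>
      have "(\<Prod>e\<in>M. x (Min e))\<^sup>2 = (\<Prod>e\<in>M. \<Prod>l\<in>e. x l)"
        unfolding prod_power_distrib
      proof (rule prod.cong[OF refl])
        fix e assume e: "e \<in> M"
        then obtain u v where uv: "e = {u, v}" "u < v" "Min e = u" "Max e = v"
          using edge by blast
        have "\<iota> (u div 2) = \<iota> (v div 2)"
          using True comp e uv(3,4) by metis
        then have "x v = x u"
          by (simp add: x_def)
        then show "(x (Min e))\<^sup>2 = (\<Prod>l\<in>e. x l)"
          unfolding uv(3) unfolding uv(1) using uv(2) by (simp add: power2_eq_square)
      qed
      also have "\<dots> = (\<Prod>l\<in>\<Union>M. x l)"
        using p finite_subset[OF _ finite_lessThan[of "2 * k"]]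
        by (subst prod.Union_disjoint) (auto simp: partition_on_def disjoint_def)
      also have "\<Union>M = {..<2 * k}"
        using p by (simp add: partition_on_def)
      also have "(\<Prod>l<2 * k. x l) = (\<Prod>v<k. x (2 * v) * x (2 * v + 1))"
        by (induction k) (simp_all add: mult.assoc)
      also have "\<dots> = (\<Prod>v<k. x (2 * v))\<^sup>2"
      proof -
        have "x (2 * v + 1) = x (2 * v)" for v
          by (simp add: x_def)
        then show ?thesis
          by (simp only: power2_eq_square prod.distrib)
      qed
      finally show ?thesis
        using nonneg by (subst (asm) power2_eq_iff_nonneg) (auto intro!: prod_nonneg simp: x_def)
    qed
    finally show ?thesis
      using True by (simp add: x_def)
  qed
qed

section \<open>Formal integrals and counterterms\<close>

lemma wick_poly_eq_sum:
  assumes "degree Q \<le> n"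
  shows "wick_poly b Q ws =
    (\<Sum>k\<le>n. coeff Q k * complex_of_real (wick b (replicate k (\<lambda>_. 1) @ ws)))"
  unfolding wick_poly_def using assms
  by (intro sum.mono_neutral_left) (auto simp: coeff_eq_0)

lemma H_add: "H b (P + Q) = H b P + H b Q"
proof -
  let ?n = "max (degree P) (degree Q)"
  have "degree (P + Q) \<le> ?n" by (rule degree_add_le_max)
  then show ?thesis
    unfolding H_def
    by (simp add: wick_poly_eq_sum[where n = ?n] sum.distrib distrib_right)
qed

lemma H_smult: "H b (smult c P) = c * H b P"
  unfolding H_def
  by (simp add: wick_poly_eq_sum[of "smult c P" "degree P"] wick_poly_eq_sum[of P "degree P"]
      degree_smult_le sum_distrib_left mult.assoc)

lemma H_0: "H b 0 = 0"
  using H_smult[of b 0 0] by simp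

lemma H_sum: "H b (\<Sum>i\<in>I. P i) = (\<Sum>i\<in>I. H b (P i))"
  by (induction I rule: infinite_finite_induct) (simp_all add: H_0 H_add)

lemma H_S1_power: "H b (S1 ^ k) = complex_of_real (wick b (replicate k (\<lambda>_. 1)))"
proof -
  have "S1 ^ k = monom (1::complex) k"
    by (simp add: monom_altdef)
  then show ?thesis
    by (simp add: H_def wick_poly_def degree_monom_eq if_distrib[of "\<lambda>c. c * _"] cong: if_cong)
qed

lemma diagram_term_constant_vertices:
  "diagram_term b (replicate k (\<lambda>_. 1) @ map (\<lambda>c _. c) cs) M \<iota> =
     prod_list cs * diagram_term b (replicate (k + length cs) (\<lambda>_. 1)) M \<iota>"
proof -
  have "(\<Prod>v<k + length cs. ((replicate k (\<lambda>_. 1) @ map (\<lambda>c _. c) cs) ! v) (\<iota> v)) =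
      (\<Prod>v<k + length cs. (replicate k 1 @ cs) ! v)"
    by (intro prod.cong) (auto simp: nth_append)
  also have "\<dots> = prod_list (replicate k 1 @ cs)"
    by (simp add: prod.list_conv_set_nth atLeast0LessThan)
  finally show ?thesis
    by (simp add: diagram_term_def)
qed

text \<open>A constant weight \<open>c\<close> makes a vertex \<open>c * S1\<close>. Scaling
  commutes with the infinite sum even without convergence, thanks to the default value 0.\<close>

lemma wick_constant_vertices:
  "wick b (replicate k (\<lambda>_. 1) @ map (\<lambda>c _. c) cs) =
     prod_list cs * wick b (replicate (k + length cs) (\<lambda>_. 1))"
  by (simp add: wick_def diagram_term_constant_vertices infsum_cmult_right' sum_distrib_left)

lemma wick_finite_constant_vertices:
  assumes "wick_finite b (replicate (k + length cs) (\<lambda>_. 1))"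
  shows "wick_finite b (replicate k (\<lambda>_. 1) @ map (\<lambda>c _. c) cs)"
  using assms unfolding wick_finite_def diagram_term_constant_vertices
  by (auto intro!: summable_on_cmult_right)

text \<open>Turns vertices of constant weight into powers of \<open>S1\<close> inside the argument
  of \<open>H\<close>, so that constant shifts of the sequence become polynomial algebra.\<close>

lemma wick_poly_constant_vertices:
  "wick_poly b Q (map (\<lambda>c _. c) cs) = of_real (prod_list cs) * H b (Q * S1 ^ length cs)"
proof -
  have "Q * S1 ^ length cs = (\<Sum>k\<le>degree Q. smult (coeff Q k) (S1 ^ (k + length cs)))"
    by (subst poly_as_sum_of_monoms[of Q, symmetric])
      (simp add: sum_distrib_right monom_altdef power_add)
  then show ?thesis
    by (simp add: H_sum H_smult H_S1_power wick_poly_def wick_constant_vertices sum_distrib_left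
        mult_ac)
qed

text \<open>Expands the power over the ways to write \<open>m\<close> as an ordered sum of
  \<open>q\<close> terms; this resums the lists of shift vertices.\<close>

lemma sum_natpermute_prod_list:
  "(\<Sum>ms\<in>natpermute m q. prod_list (map (fps_nth G) ms)) = fps_nth (G ^ q) m"
  for G :: "'a::comm_ring_1 fps"
proof (cases q)
  case 0
  then show ?thesis
    by (simp add: natpermute_0)
next
  case (Suc q')
  have "prod_list (map (fps_nth G) ms) = (\<Prod>j = 0..q'. fps_nth G (ms ! j))"
    if "ms \<in> natpermute m q" for ms
    using that Suc by (auto simp: natpermute_def prod.list_conv_set_nth atLeastLessThanSuc_atLeastAtMost
      intro!: prod.cong)
  then show ?thesis
    using Suc by (simp add: fps_power_nth_Suc del: power_Suc)
qed

text \<open>The rule exp(t(P + w)) = exp(tw) exp(tP), which on coefficients is the binomial theorem.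
  A constant in the exponent thus amounts to an overall exponential factor.\<close>

lemma exp_integral_add_const:
  "exp_integral b (P + [:w:]) = fps_exp w * exp_integral b P"
proof (rule fps_ext)
  fix n
  have "H b ((P + [:w:]) ^ n) / fact n =
      (\<Sum>k\<le>n. of_nat (n choose k) * (w ^ k * H b (P ^ (n - k)))) / fact n"
    by (simp add: add.commute[of P] binomial_ring H_sum poly_const_pow H_smult
        of_nat_poly mult_ac)
  also have "\<dots> = (\<Sum>k = 0..n. w ^ k / fact k * (H b (P ^ (n - k)) / fact (n - k)))"
    unfolding sum_divide_distrib atMost_atLeast0
    by (intro sum.cong refl) (simp add: binomial_fact field_simps)
  finally show "fps_nth (exp_integral b (P + [:w:])) n = fps_nth (fps_exp w * exp_integral b P) n"
    by (simp add: exp_integral_def fps_mult_nth)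
qed

lemma shift_vertices_linear:
  assumes "\<And>j. g (4 + j) = G"
  shows "shift_vertices g ms = map (\<lambda>c _. c) (map (fps_nth G) ms)"
  using assms by (simp add: shift_vertices_def)

text \<open>Counterterms linear in the parameter are absorbed in the exponent: the shift
  \<open>a * t\<close> of every \<open>b j\<close> subtracts \<open>a * S1\<close> from
  \<open>P\<close>, and the prefactor \<open>exp (w * t)\<close> adds the constant
  \<open>w\<close>.\<close>

lemma shifted_integral_linear:
  assumes g3: "g 3 = 0" and g4: "\<And>j. g (4 + j) = fps_const a * fps_X"
    and pre: "complex_fps (g 1) + fps_const \<i> * complex_fps (g 2) = fps_const w * fps_X"
  shows "shifted_integral b P g = exp_integral b (P - smult (of_real a) S1 + [:w:])"
proof -
  let ?G = "fps_const a * fps_X"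
  \<comment> \<open>Each of the \<open>q\<close> vertices carries the monomial \<open>a * t\<close>,
    so only the coefficient of \<open>t ^ q\<close> survives.\<close>
  have inner: "(\<Sum>ms\<in>natpermute m q. wick_poly b Q (shift_vertices g ms)) =
      (if m = q then of_real a ^ q * H b (Q * S1 ^ q) else 0)" for m q Q
  proof -
    have "wick_poly b Q (shift_vertices g ms) =
        of_real (prod_list (map (fps_nth ?G) ms)) * H b (Q * S1 ^ q)" if "ms \<in> natpermute m q" for ms
      using that unfolding shift_vertices_linear[of g ?G ms, OF g4]
      by (subst wick_poly_constant_vertices) (simp add: natpermute_def)
    then have "(\<Sum>ms\<in>natpermute m q. wick_poly b Q (shift_vertices g ms)) =
        of_real (\<Sum>ms\<in>natpermute m q. prod_list (map (fps_nth ?G) ms)) * H b (Q * S1 ^ q)"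
      by (simp add: sum_distrib_right)
    also have "\<dots> = of_real (fps_nth (?G ^ q) m) * H b (Q * S1 ^ q)"
      by (simp only: sum_natpermute_prod_list)
    also have "fps_nth (?G ^ q) m = (if m = q then a ^ q else 0)"
      by (simp add: power_mult_distrib fps_const_power fps_X_power_iff)
    finally show ?thesis
      by simp
  qed
  have "fps_nth (Abs_fps (\<lambda>n. \<Sum>m\<le>n. \<Sum>p\<le>n - m. \<Sum>q\<le>m.
       fps_nth ((fps_X + complex_fps (g 3)) ^ p) (n - m) / fact p * ((-1) ^ q / fact q) *
       (\<Sum>ms\<in>natpermute m q. wick_poly b (P ^ p) (shift_vertices g ms)))) n =
      fps_nth (exp_integral b (P - smult (of_real a) S1)) n" for n
  proof -
    have c0: "complex_fps 0 = 0"
      by (simp add: complex_fps_def fps_eq_iff)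
    have "(\<Sum>m\<le>n. \<Sum>p\<le>n - m. \<Sum>q\<le>m.
         fps_nth ((fps_X + complex_fps (g 3)) ^ p) (n - m) / fact p * ((-1) ^ q / fact q) *
         (\<Sum>ms\<in>natpermute m q. wick_poly b (P ^ p) (shift_vertices g ms))) =
        (\<Sum>m\<le>n. 1 / fact (n - m) * ((-1) ^ m / fact m) * (of_real a ^ m * H b (P ^ (n - m) * S1 ^ m)))"
    proof (rule sum.cong[OF refl])
      fix m
      show "(\<Sum>p\<le>n - m. \<Sum>q\<le>m.
         fps_nth ((fps_X + complex_fps (g 3)) ^ p) (n - m) / fact p * ((-1) ^ q / fact q) *
         (\<Sum>ms\<in>natpermute m q. wick_poly b (P ^ p) (shift_vertices g ms))) =
         1 / fact (n - m) * ((-1) ^ m / fact m) * (of_real a ^ m * H b (P ^ (n - m) * S1 ^ m))"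
        (is "?l = _")
      proof -
        \<comment> \<open>Since \<open>g 3 = 0\<close>, only \<open>p = n - m\<close> contributes,
          and by \<open>inner\<close> only \<open>q = m\<close>.\<close>
        have "?l = (\<Sum>p\<le>n - m. if p = n - m then \<Sum>q\<le>m. if q = m then
           1 / fact p * ((-1) ^ q / fact q) * (of_real a ^ q * H b (P ^ p * S1 ^ q)) else 0 else 0)"
          unfolding inner g3 c0
          by (intro sum.cong refl)
            (auto simp: fps_X_power_iff simp del: sum.delta sum.delta'
              intro!: sum.cong)
        also have "\<dots> = 1 / fact (n - m) * ((-1) ^ m / fact m) *
            (of_real a ^ m * H b (P ^ (n - m) * S1 ^ m))"
          by simp
        finally show ?thesis .
      qed
    qed
    \<comment> \<open>What remains is the binomial expansion of
      \<open>(P - a * S1) ^ n / n!\<close>.\<close>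
    also have "\<dots> = H b ((smult (- of_real a) S1 + P) ^ n) / fact n"
    proof -
      have pow: "smult c S1 ^ m * Q = smult (c ^ m) (Q * S1 ^ m)" for c m Q
        by (simp only: smult_power mult_smult_left mult_smult_right mult.commute)
      have expand: "H b ((smult (- of_real a) S1 + P) ^ n) =
          (\<Sum>m\<le>n. of_nat (n choose m) * ((- of_real a) ^ m * H b (P ^ (n - m) * S1 ^ m)))"
        unfolding binomial_ring H_sum mult.assoc pow
        by (simp add: of_nat_poly H_smult mult_ac)
      show ?thesis
        unfolding expand sum_divide_distrib
        by (intro sum.cong refl)
          (simp add: binomial_fact field_simps power_minus[of "complex_of_real a"])
    qed
    also have "smult (- of_real a) S1 + P = P - smult (of_real a) S1"
      by simp
    finally show ?thesis
      by (simp add: exp_integral_def)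
  qed
  then have "shifted_integral b P g =
      (fps_exp 1 oo (fps_const w * fps_X)) * exp_integral b (P - smult (of_real a) S1)"
    unfolding shifted_integral_def pre by (intro arg_cong2[where f = "(*)"] refl fps_ext)
  then show ?thesis
    by (simp only: exp_integral_add_const fps_exp_compose_linear mult_1_right)
qed

lemma H_finite_if_wick_finite:
  "(\<And>k. wick_finite b (replicate k (\<lambda>_. 1))) \<Longrightarrow> H_finite b Q"
  by (simp add: H_finite_def wick_poly_finite_def)

lemma shifted_integral_finite_linear:
  assumes "\<And>k. wick_finite b (replicate k (\<lambda>_. 1))" and "\<And>j. g (4 + j) = G"
  shows "shifted_integral_finite b P g"
  unfolding shifted_integral_finite_def wick_poly_finite_def shift_vertices_linear[of g G, OF assms(2)]
  using assms(1) wick_finite_constant_vertices by blast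

lemma exp_integral_smult:
  "exp_integral b (smult c P) = Abs_fps (\<lambda>j. c ^ j / fact j * H b (P ^ j))"
  by (simp add: exp_integral_def smult_power H_smult)

section \<open>Moments\<close>

lemma has_sum_finite_sum:
  fixes f :: "'i \<Rightarrow> 'a \<Rightarrow> 'b::topological_comm_monoid_add"
  assumes "\<And>i. i \<in> I \<Longrightarrow> (f i has_sum s i) A"
  shows "((\<lambda>x. \<Sum>i\<in>I. f i x) has_sum (\<Sum>i\<in>I. s i)) A"
  using assms by (induction I rule: infinite_finite_induct) (auto intro: has_sum_add)

lemma compatible_subset_line_matchings: "compatible k \<iota> \<subseteq> line_matchings k"
  unfolding compatible_def color_matchings_def line_matchings_def by blast

lemma finite_line_matchings: "finite (line_matchings k)"
  by (rule finite_subset[OF _ finitely_many_partition_on[of "{..<2 * k}"]])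
    (auto simp: line_matchings_def)

text \<open>With \<open>x\<^sub>j = 1 / (2 * b\<^sub>j)\<close>, the case \<open>p = 0\<close> is the \<open>k\<close>-th moment of \<open>S\<^sub>1\<close>
  (for every \<open>u\<close>).\<close>

definition weighted_moment :: "(nat \<Rightarrow> real) \<Rightarrow> nat \<Rightarrow> nat \<Rightarrow> nat \<Rightarrow> real" where
  "weighted_moment x p u k = (\<Sum>\<^sub>\<infinity>\<iota>\<in>{..<k} \<rightarrow>\<^sub>E UNIV.
     real (card (compatible k \<iota>)) * (\<Prod>v<k. x (\<iota> v)) * x (\<iota> u) ^ p)"

text \<open>For \<open>x j = 1 / (2 * b j)\<close> and \<open>p\<close> \<ge> 1 this is the value of
  a circle with \<open>p\<close> vertices.\<close>

definition power_sum :: "(nat \<Rightarrow> real) \<Rightarrow> nat \<Rightarrow> real" where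
  "power_sum x p = (\<Sum>\<^sub>\<infinity>j. x j ^ p)"

text \<open>Exchanging \<open>u\<close> and \<open>w\<close> in the index assignments is a bijection
  that moves the extra power from one vertex to the other; the count of matchings and the product
  are symmetric.\<close>

lemma weighted_moment_symmetric:
  assumes "u < k" "w < k"
  shows "weighted_moment x p u k = weighted_moment x p w k"
proof -
  define \<sigma> where "\<sigma> = Transposition.transpose u w"
  have \<sigma>: "\<sigma> permutes {..<k}"
    unfolding \<sigma>_def using assms by (intro permutes_swap_id) auto
  have inv: "\<sigma> (\<sigma> v) = v" for v
    by (simp add: \<sigma>_def)
  have ext: "\<iota> \<circ> \<sigma> \<in> {..<k} \<rightarrow>\<^sub>E UNIV" if "\<iota> \<in> {..<k} \<rightarrow>\<^sub>E UNIV" for \<iota> :: "nat \<Rightarrow> nat"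
    using that permutes_not_in[OF \<sigma>] by (auto simp: PiE_def extensional_def)
  have bij: "bij_betw (\<lambda>\<iota>. \<iota> \<circ> \<sigma>) ({..<k} \<rightarrow>\<^sub>E (UNIV :: nat set)) ({..<k} \<rightarrow>\<^sub>E UNIV)"
    by (rule bij_betw_byWitness[where f' = "\<lambda>\<iota>. \<iota> \<circ> \<sigma>"]) (use ext inv in \<open>auto simp: fun_eq_iff\<close>)
  let ?f = "\<lambda>w \<iota>. real (card (compatible k \<iota>)) * (\<Prod>v<k. x (\<iota> v)) * x (\<iota> w) ^ p"
  have "?f w (\<iota> \<circ> \<sigma>) = ?f u \<iota>" for \<iota>
  proof -
    have "(\<Prod>v<k. x ((\<iota> \<circ> \<sigma>) v)) = (\<Prod>v<k. x (\<iota> v))"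
      using prod.permute[OF \<sigma>, of "\<lambda>v. x (\<iota> v)"] by (simp add: o_def)
    moreover have "(\<iota> \<circ> \<sigma>) w = \<iota> u"
      by (simp add: \<sigma>_def)
    ultimately show ?thesis
      by (simp only: card_compatible_permute[OF \<sigma>])
  qed
  then show ?thesis
    unfolding weighted_moment_def using infsum_reindex_bij_betw[OF bij, of "?f w"] by simp
qed

section \<open>Moments for nonnegative summable weights\<close>

context
  fixes x :: "nat \<Rightarrow> real"
  assumes nonneg: "\<And>j. 0 \<le> x j" and summ: "x summable_on UNIV"
begin

lemma le_infsum: "x j \<le> infsum x UNIV"
  using finite_sum_le_infsum[OF summ, of "{j}"] nonneg by simp

text \<open>\<open>x\<close> is bounded by its sum, so its powers are dominated by a multiple of
  \<open>x\<close>.\<close>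

lemma summable_on_power: "(\<lambda>j. x j ^ Suc p) summable_on UNIV"
proof (rule summable_on_comparison_test)
  show "(\<lambda>j. infsum x UNIV ^ p * x j) summable_on UNIV"
    by (intro summable_on_cmult_right summ)
  show "x j ^ Suc p \<le> infsum x UNIV ^ p * x j" for j
    using power_mono[OF le_infsum nonneg, of j p] nonneg[of j] by (simp add: mult_mono mult.commute)
qed (use nonneg in simp)

lemma summable_on_prod: "(\<lambda>\<iota>. \<Prod>v<k. x (\<iota> v)) summable_on ({..<k} \<rightarrow>\<^sub>E UNIV)" for k :: nat
proof -
  have "Infinite_Set_Sum.abs_summable_on x UNIV"
    unfolding abs_summable_equivalent[symmetric] using summ
    by (rule summable_on_iff_abs_summable_on_real[THEN iffD1])
  then have "Infinite_Set_Sum.abs_summable_on (\<lambda>\<iota>. \<Prod>v<k. x (\<iota> v)) ({..<k} \<rightarrow>\<^sub>E UNIV)"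
    by (intro Infinite_Set_Sum.abs_summable_on_prod_PiE) auto
  then show ?thesis
    unfolding abs_summable_equivalent[symmetric]
    by (rule summable_on_iff_abs_summable_on_real[THEN iffD2])
qed

text \<open>Dominated by a multiple of the plain product: the compatible matchings are among the
  finitely many matchings, and the extra power is bounded.\<close>

lemma summable_on_weighted:
  "(\<lambda>\<iota>. real (card (compatible k \<iota>)) * (\<Prod>v<k. x (\<iota> v)) * x (\<iota> u) ^ p)
     summable_on ({..<k} \<rightarrow>\<^sub>E UNIV)"
proof (rule summable_on_comparison_test)
  let ?K = "real (card (line_matchings k)) * infsum x UNIV ^ p"
  show "(\<lambda>\<iota>. ?K * (\<Prod>v<k. x (\<iota> v))) summable_on ({..<k} \<rightarrow>\<^sub>E UNIV)"
    by (intro summable_on_cmult_right summable_on_prod)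
  show "real (card (compatible k \<iota>)) * (\<Prod>v<k. x (\<iota> v)) * x (\<iota> u) ^ p \<le>
      ?K * (\<Prod>v<k. x (\<iota> v))" for \<iota>
  proof -
    have "real (card (compatible k \<iota>)) * x (\<iota> u) ^ p \<le> ?K"
      using nonneg le_infsum
      by (intro mult_mono power_mono)
        (auto intro!: card_mono finite_line_matchings compatible_subset_line_matchings)
    then have "real (card (compatible k \<iota>)) * x (\<iota> u) ^ p * (\<Prod>v<k. x (\<iota> v)) \<le>
        ?K * (\<Prod>v<k. x (\<iota> v))"
      using nonneg by (intro mult_right_mono prod_nonneg) auto
    then show ?thesis
      by (simp add: mult_ac)
  qed
qed (use nonneg in \<open>auto intro!: mult_nonneg_nonneg prod_nonneg\<close>)

text \<open>The last vertex \<open>k\<close> either closes on itself or is inserted into one of the two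
  positions next to a vertex \<open>v\<close> of the same index, which raises the power at \<open>v\<close> by one.\<close>

lemma weighted_moment_Suc:
  "weighted_moment x p k (Suc k) =
     power_sum x (Suc p) * weighted_moment x 0 0 k +
     2 * real k * weighted_moment x (Suc p) (k - 1) k"
proof -
  define N where "N \<iota> = real (card (compatible k \<iota>)) * (\<Prod>v<k. x (\<iota> v))" for \<iota>
  define F where "F \<iota> = real (card (compatible (Suc k) \<iota>)) * (\<Prod>v<Suc k. x (\<iota> v)) * x (\<iota> k) ^ p" for \<iota>
  let ?\<Pi> = "\<lambda>k::nat. {..<k} \<rightarrow>\<^sub>E (UNIV :: nat set)"
  have bij: "bij_betw (\<lambda>(\<iota>, j). \<iota>(k := j)) (?\<Pi> k \<times> UNIV) (?\<Pi> (Suc k))"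
  proof -
    have "bij_betw (\<lambda>(j, \<iota>). \<iota>(k := j)) (UNIV \<times> ?\<Pi> k) (?\<Pi> (Suc k))"
      unfolding lessThan_Suc PiE_insert_eq bij_betw_def
      using inj_combinator[of k "{..<k}" "\<lambda>_. UNIV"] by simp
    from bij_betw_trans[OF bij_betw_byWitness[where f = prod.swap and f' = prod.swap
          and A = "?\<Pi> k \<times> UNIV" and A' = "UNIV \<times> ?\<Pi> k"] this]
    show ?thesis
      by (simp add: o_def case_prod_unfold product_swap)
  qed
  \<comment> \<open>The number of earlier vertices of index \<open>j\<close> is written as a sum of
    indicators over \<open>v\<close>, so that the sum over \<open>j\<close> just picks the term
    \<open>x (\<iota> v) ^ Suc p\<close> for each \<open>v\<close>.\<close>
  have F_upd: "F (\<iota>(k := j)) =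
      N \<iota> * (x j ^ Suc p + 2 * (\<Sum>v<k. if j = \<iota> v then x (\<iota> v) ^ Suc p else 0))" for \<iota> j
  proof -
    have "real (card {v\<in>{..<k}. \<iota> v = j}) * x j ^ Suc p = (\<Sum>v\<in>{v\<in>{..<k}. \<iota> v = j}. x j ^ Suc p)"
      by simp
    also have "\<dots> = (\<Sum>v<k. if j = \<iota> v then x (\<iota> v) ^ Suc p else 0)"
      by (subst sum.inter_filter) (auto intro!: sum.cong)
    finally have "(1 + 2 * real (card {v\<in>{..<k}. \<iota> v = j})) * x j ^ Suc p =
        x j ^ Suc p + 2 * (\<Sum>v<k. if j = \<iota> v then x (\<iota> v) ^ Suc p else 0)"
      by (simp add: distrib_right)
    moreover have "F (\<iota>(k := j)) =
        N \<iota> * ((1 + 2 * real (card {v\<in>{..<k}. \<iota> v = j})) * x j ^ Suc p)"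
      unfolding F_def N_def card_compatible_Suc by (simp add: algebra_simps)
    ultimately show ?thesis
      by simp
  qed
  have inner: "((\<lambda>j. F (\<iota>(k := j))) has_sum
      (N \<iota> * (power_sum x (Suc p) + 2 * (\<Sum>v<k. x (\<iota> v) ^ Suc p)))) UNIV" for \<iota>
  proof -
    have "((\<lambda>j. if j = \<iota> v then x (\<iota> v) ^ Suc p else 0) has_sum x (\<iota> v) ^ Suc p) UNIV" for v
      by (rule has_sum_finite_neutralI[of "{\<iota> v}"]) auto
    moreover have "((\<lambda>j. x j ^ Suc p) has_sum power_sum x (Suc p)) UNIV"
      unfolding power_sum_def using summable_on_power by (rule has_sum_infsum)
    ultimately show ?thesis
      unfolding F_upd by (intro has_sum_cmult_right has_sum_add has_sum_finite_sum)
  qed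
  have summF: "(\<lambda>(\<iota>, j). F (\<iota>(k := j))) summable_on (?\<Pi> k \<times> UNIV)"
  proof -
    have "F summable_on ?\<Pi> (Suc k)"
      unfolding F_def by (rule summable_on_weighted)
    then show ?thesis
      by (simp add: summable_on_reindex_bij_betw[OF bij, of F, symmetric] case_prod_unfold)
  qed
  have "weighted_moment x p k (Suc k) = infsum F (?\<Pi> (Suc k))"
    unfolding weighted_moment_def F_def by (rule refl)
  also have "\<dots> = (\<Sum>\<^sub>\<infinity>(\<iota>, j)\<in>?\<Pi> k \<times> UNIV. F (\<iota>(k := j)))"
    using infsum_reindex_bij_betw[OF bij, of F] by (simp add: case_prod_unfold)
  also have "\<dots> = (\<Sum>\<^sub>\<infinity>\<iota>\<in>?\<Pi> k. \<Sum>\<^sub>\<infinity>j. F (\<iota>(k := j)))"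
    by (rule infsum_Sigma'_banach[OF summF, symmetric])
  also have "\<dots> = (\<Sum>\<^sub>\<infinity>\<iota>\<in>?\<Pi> k. N \<iota> * (power_sum x (Suc p) + 2 * (\<Sum>v<k. x (\<iota> v) ^ Suc p)))"
    using inner by (intro infsum_cong infsumI)
  also have "\<dots> = power_sum x (Suc p) * weighted_moment x 0 0 k +
      2 * (\<Sum>v<k. weighted_moment x (Suc p) v k)"
  proof (rule infsumI)
    have "((\<lambda>\<iota>. N \<iota> * x (\<iota> v) ^ q) has_sum weighted_moment x q v k) (?\<Pi> k)" for v q
      unfolding N_def weighted_moment_def using summable_on_weighted by (rule has_sum_infsum)
    from this[where q = "Suc p"] this[where q = 0 and v = 0]
    have "((\<lambda>\<iota>. power_sum x (Suc p) * N \<iota> + 2 * (\<Sum>v<k. N \<iota> * x (\<iota> v) ^ Suc p)) has_sum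
        (power_sum x (Suc p) * weighted_moment x 0 0 k +
         2 * (\<Sum>v<k. weighted_moment x (Suc p) v k))) (?\<Pi> k)"
      by (intro has_sum_add has_sum_cmult_right has_sum_finite_sum) simp_all
    then show "((\<lambda>\<iota>. N \<iota> * (power_sum x (Suc p) + 2 * (\<Sum>v<k. x (\<iota> v) ^ Suc p))) has_sum
        (power_sum x (Suc p) * weighted_moment x 0 0 k +
         2 * (\<Sum>v<k. weighted_moment x (Suc p) v k))) (?\<Pi> k)"
      by (simp add: algebra_simps sum_distrib_left)
  qed
  \<comment> \<open>By symmetry all vertices contribute equally; the last one is chosen so that the
    recursion applies again. For \<open>k = 0\<close> the sum is empty.\<close>
  also have "(\<Sum>v<k. weighted_moment x (Suc p) v k) = (\<Sum>v<k. weighted_moment x (Suc p) (k - 1) k)"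
    by (intro sum.cong refl weighted_moment_symmetric) auto
  finally show ?thesis
    by simp
qed

text \<open>Iterates the recursion until no vertex is left. For \<open>p = 0\<close> the term
  \<open>i\<close> belongs to the matchings whose circle through the last vertex has
  \<open>i + 1\<close> vertices; the factorials make the sum a Cauchy product.\<close>

lemma weighted_moment_expand:
  "weighted_moment x p k (Suc k) / fact k =
     (\<Sum>i\<le>k. 2 ^ i * power_sum x (Suc (p + i)) * (weighted_moment x 0 0 (k - i) / fact (k - i)))"
proof (induction k arbitrary: p)
  case 0
  then show ?case
    by (simp add: weighted_moment_Suc[of p 0])
next
  case (Suc k)
  have "weighted_moment x p (Suc k) (Suc (Suc k)) / fact (Suc k) =
      power_sum x (Suc p) * (weighted_moment x 0 0 (Suc k) / fact (Suc k)) +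
      2 * (weighted_moment x (Suc p) k (Suc k) / fact k)"
    by (simp add: weighted_moment_Suc[of p "Suc k"] field_simps del: of_nat_Suc)
  then show ?case
    unfolding Suc.IH sum.atMost_Suc_shift by (simp add: sum_distrib_left mult_ac)
qed

end

text \<open>Without vertices there is one matching, the empty one, and one index assignment, with
  empty products as value.\<close>

lemma exp_integral_nth_0: "fps_nth (exp_integral b P) 0 = 1"
proof -
  have "line_matchings 0 = {{}}"
    by (auto simp: line_matchings_def partition_on_empty)
  then have "H b (S1 ^ 0) = 1"
    unfolding H_S1_power by (simp add: wick_def diagram_term_def)
  then show ?thesis
    by (simp add: exp_integral_def)
qed

lemma diagram_term_ones:
  assumes "\<And>j. 0 \<le> b j" "M \<in> line_matchings k"
  shows "diagram_term b (replicate k (\<lambda>_. 1)) M \<iota> =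
    (if M \<in> compatible k \<iota> then \<Prod>v<k. 1 / (2 * b (\<iota> v)) else 0)"
  using prod_propagators[of M k b \<iota>] assms by (simp add: diagram_term_def)

context
  fixes b :: "nat \<Rightarrow> real"
  assumes b_nonneg: "\<And>j. 0 \<le> b j" and summable_inverse: "summable (\<lambda>j. 1 / b j)"
begin

text \<open>The propagator values. An index with \<open>b j = 0\<close> gets the value 0, as
  intended where \<open>\<rho>\<close> vanishes.\<close>

abbreviation (input) halves :: "nat \<Rightarrow> real" where
  "halves j \<equiv> 1 / (2 * b j)"

lemma halves_nonneg: "0 \<le> halves j"
  using b_nonneg by simp

lemma summable_on_halves: "halves summable_on UNIV"
proof -
  have "summable (\<lambda>j. (1 / b j) * (1 / 2))"
    using summable_inverse by (rule summable_mult2)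
  then show ?thesis
    using b_nonneg by (subst summable_on_UNIV_nonneg_real_iff) (auto simp: mult.commute)
qed

text \<open>The factor \<open>2 ^ i\<close> from the moment expansion cancels all but one of the
  \<open>i + 1\<close> halves.\<close>

lemma power_sum_halves: "2 ^ i * power_sum halves (Suc i) = (\<Sum>j. (1 / b j) ^ Suc i) / 2"
proof -
  have "summable (\<lambda>j. halves j ^ Suc i)"
    using summable_on_power[OF halves_nonneg summable_on_halves, of i] b_nonneg
    by (subst (asm) summable_on_UNIV_nonneg_real_iff) auto
  then have s: "(\<lambda>j. halves j ^ Suc i) sums (\<Sum>j. halves j ^ Suc i)"
    by (rule summable_sums)
  then have "power_sum halves (Suc i) = (\<Sum>j. halves j ^ Suc i)"
    unfolding power_sum_def
    by (intro infsumI sums_nonneg_imp_has_sum) (auto simp: b_nonneg)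
  moreover have "(\<lambda>j. 2 ^ Suc i * halves j ^ Suc i) sums (2 ^ Suc i * (\<Sum>j. halves j ^ Suc i))"
    using s by (rule sums_mult)
  then have "(\<lambda>j. (1 / b j) ^ Suc i) sums (2 ^ Suc i * (\<Sum>j. halves j ^ Suc i))"
    by (simp add: power_divide power_mult_distrib field_simps)
  then have "(\<Sum>j. (1 / b j) ^ Suc i) = 2 ^ Suc i * (\<Sum>j. halves j ^ Suc i)"
    by (rule sums_unique[symmetric])
  ultimately show ?thesis
    by simp
qed

lemma summable_on_diagram_term:
  assumes "M \<in> line_matchings k"
  shows "diagram_term b (replicate k (\<lambda>_. 1)) M summable_on ({..<k} \<rightarrow>\<^sub>E UNIV)"
proof (rule summable_on_comparison_test)
  show "(\<lambda>\<iota>. \<Prod>v<k. halves (\<iota> v)) summable_on ({..<k} \<rightarrow>\<^sub>E UNIV)"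
    by (rule summable_on_prod[OF halves_nonneg summable_on_halves])
qed (use diagram_term_ones[OF b_nonneg assms] b_nonneg in \<open>auto intro!: prod_nonneg\<close>)

lemma wick_finite_ones: "wick_finite b (replicate k (\<lambda>_. 1))"
  unfolding wick_finite_def using summable_on_diagram_term by simp

text \<open>Interchanges the finite sum over matchings with the sum over index assignments; for a
  fixed assignment all compatible matchings have the same value, so only their number
  matters.\<close>

lemma wick_ones: "wick b (replicate k (\<lambda>_. 1)) = weighted_moment halves 0 0 k"
proof -
  let ?D = "diagram_term b (replicate k (\<lambda>_. 1))"
  have "(\<Sum>M\<in>line_matchings k. ?D M \<iota>) = real (card (compatible k \<iota>)) * (\<Prod>v<k. halves (\<iota> v))" for \<iota>
  proof -
    have "(\<Sum>M\<in>line_matchings k. ?D M \<iota>) =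
        (\<Sum>M\<in>line_matchings k. if M \<in> compatible k \<iota> then \<Prod>v<k. halves (\<iota> v) else 0)"
      using diagram_term_ones[OF b_nonneg] by (intro sum.cong) auto
    also have "\<dots> = (\<Sum>M\<in>line_matchings k \<inter> compatible k \<iota>. \<Prod>v<k. halves (\<iota> v))"
      by (rule sum.inter_restrict[OF finite_line_matchings, symmetric])
    also have "line_matchings k \<inter> compatible k \<iota> = compatible k \<iota>"
      using compatible_subset_line_matchings by blast
    finally show ?thesis
      by (simp del: times_divide_eq_right)
  qed
  moreover have "((\<lambda>\<iota>. \<Sum>M\<in>line_matchings k. ?D M \<iota>) has_sum
      (\<Sum>M\<in>line_matchings k. infsum (?D M) ({..<k} \<rightarrow>\<^sub>E UNIV))) ({..<k} \<rightarrow>\<^sub>E UNIV)"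
    by (rule has_sum_finite_sum, rule has_sum_infsum, rule summable_on_diagram_term)
  ultimately show ?thesis
    unfolding wick_def weighted_moment_def by (simp add: has_sum_iff)
qed

text \<open>The moment expansion read as a product of series. Formally the solution is the Gaussian
  integral, the product over \<open>j\<close> of \<open>(1 - t / b j)\<close> to the power
  -1/2.\<close>

lemma exp_integral_S1_deriv:
  "fps_deriv (exp_integral b S1) =
     exp_integral b S1 * Abs_fps (\<lambda>i. complex_of_real ((\<Sum>j. (1 / b j) ^ Suc i) / 2))"
proof (rule fps_ext)
  fix k
  have moment: "fps_nth (exp_integral b S1) n = complex_of_real (weighted_moment halves 0 0 n / fact n)" for n
    by (simp add: exp_integral_def H_S1_power wick_ones)
  \<comment> \<open>For \<open>p = 0\<close> the marked vertex is immaterial, so it can be taken to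
    be the last one, to which the expansion applies.\<close>
  have "fps_nth (fps_deriv (exp_integral b S1)) k =
      complex_of_real (weighted_moment halves 0 k (Suc k) / fact k)"
    by (simp add: moment weighted_moment_def field_simps del: of_nat_Suc)
  also have "\<dots> = (\<Sum>i\<le>k. complex_of_real ((\<Sum>j. (1 / b j) ^ Suc i) / 2) *
      fps_nth (exp_integral b S1) (k - i))"
    unfolding weighted_moment_expand[OF halves_nonneg summable_on_halves] moment
    by (simp only: add_0 power_sum_halves of_real_sum of_real_mult)
  finally show "fps_nth (fps_deriv (exp_integral b S1)) k = fps_nth (exp_integral b S1 *
      Abs_fps (\<lambda>i. complex_of_real ((\<Sum>j. (1 / b j) ^ Suc i) / 2))) k"
    by (simp add: mult.commute[of "exp_integral b S1"] fps_mult_nth atMost_atLeast0)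
qed

text \<open>The factor \<open>fps_exp w\<close> adds \<open>w\<close> to the logarithmic
  derivative.\<close>

lemma exp_integral_shifted_S1_deriv:
  "fps_deriv (exp_integral b (S1 + [:w:])) = exp_integral b (S1 + [:w:]) *
     (Abs_fps (\<lambda>i. complex_of_real ((\<Sum>j. (1 / b j) ^ Suc i) / 2)) + fps_const w)"
  unfolding exp_integral_add_const
  by (simp add: exp_integral_S1_deriv algebra_simps)

end

text \<open>The equation gives the coefficient \<open>k + 1\<close> of \<open>D\<close> as a fixed
  polynomial in earlier coefficients of \<open>D\<close> and coefficients of \<open>G\<close>, so
  limits pass on by induction.\<close>

lemma fps_deriv_eq_mult_tendsto:
  fixes D G :: "'a \<Rightarrow> 'b::{real_normed_field} fps"
  assumes ode: "\<forall>\<^sub>F z in F. fps_deriv (D z) = D z * G z"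
    and initial: "\<forall>\<^sub>F z in F. fps_nth (D z) 0 = d"
    and G: "\<And>n. \<exists>L. ((\<lambda>z. fps_nth (G z) n) \<longlongrightarrow> L) F"
  shows "\<exists>L. ((\<lambda>z. fps_nth (D z) n) \<longlongrightarrow> L) F"
proof (induction n rule: less_induct)
  case (less n)
  show ?case
  proof (cases n)
    case 0
    then show ?thesis
      using tendsto_eventually[OF initial] by blast
  next
    case (Suc k)
    from less Suc obtain d' where d': "\<And>i. i \<le> k \<Longrightarrow> ((\<lambda>z. fps_nth (D z) i) \<longlongrightarrow> d' i) F"
      by (metis le_imp_less_Suc)
    from G obtain g where g: "\<And>n. ((\<lambda>z. fps_nth (G z) n) \<longlongrightarrow> g n) F"
      by metis
    have "((\<lambda>z. (\<Sum>i = 0..k. fps_nth (D z) i * fps_nth (G z) (k - i)) / of_nat (Suc k)) \<longlongrightarrow>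
        (\<Sum>i = 0..k. d' i * g (k - i)) / of_nat (Suc k)) F"
      by (intro tendsto_intros d' g) (auto simp del: of_nat_Suc)
    moreover have "\<forall>\<^sub>F z in F. (\<Sum>i = 0..k. fps_nth (D z) i * fps_nth (G z) (k - i)) / of_nat (Suc k) =
        fps_nth (D z) n"
      using ode
    proof eventually_elim
      case (elim z)
      have "(\<Sum>i = 0..k. fps_nth (D z) i * fps_nth (G z) (k - i)) =
          of_nat (Suc k) * fps_nth (D z) n"
        by (simp only: fps_mult_nth[symmetric] elim[symmetric] fps_deriv_nth Suc Suc_eq_plus1)
      then show ?case
        by (simp del: of_nat_Suc)
    qed
    ultimately have "((\<lambda>z. fps_nth (D z) n) \<longlongrightarrow>
        (\<Sum>i = 0..k. d' i * g (k - i)) / of_nat (Suc k)) F"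
      by (rule Lim_transform_eventually)
    then show ?thesis ..
  qed
qed

section \<open>Removal of the regularization\<close>

text \<open>Reduces renormalization to an identity between exponents and to convergence: the
  counterterms are the parameter times functions of \<Lambda>, hence vanish with the parameter and
  diverge with their factor.\<close>

lemma renormalization_linear:
  fixes a w1 w2 :: "real \<Rightarrow> real" and P :: "complex poly"
  defines "Q \<equiv> \<lambda>\<Lambda>. P - smult (of_real (a \<Lambda>)) S1 + [:Complex (w1 \<Lambda>) (w2 \<Lambda>):]"
  assumes diverge: "\<And>c. c \<in> {a, w1, w2} \<Longrightarrow> c = (\<lambda>_. 0) \<or> filterlim c at_infinity at_top"
    and finite: "\<forall>\<^sub>F \<Lambda> in at_top. \<forall>k. wick_finite (b \<Lambda>) (replicate k (\<lambda>_. 1))"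
    and lim: "\<And>n. \<exists>L. ((\<lambda>\<Lambda>. fps_nth (exp_integral (b \<Lambda>) (Q \<Lambda>)) n) \<longlongrightarrow> L) at_top"
  shows "renormalization b P (\<lambda>\<Lambda>. exp_integral (b \<Lambda>) P) (\<lambda>\<Lambda>. exp_integral (b \<Lambda>) (Q \<Lambda>))"
proof -
  \<comment> \<open>\<open>w1\<close> and \<open>w2\<close> give the overall factor, the parameter
    itself is not shifted, and all entries of the sequence are shifted by the same
    \<open>a\<close>.\<close>
  define c where "c i = (if i = 1 then w1 else if i = 2 then w2 else if i = 3 then \<lambda>_. 0 else a)"
    for i :: nat
  define h where "h i \<Lambda> t = c i \<Lambda> * t" for i \<Lambda> t
  define g where "g i \<Lambda> = fps_const (c i \<Lambda>) * fps_X" for i \<Lambda>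
  have c: "c i = (\<lambda>_. 0) \<or> filterlim (c i) at_infinity at_top" for i
    using diverge by (simp add: c_def)
  have "counterterms h g"
    unfolding counterterms_def
  proof (intro allI impI conjI)
    fix i :: nat and \<Lambda>
    show "h i \<Lambda> has_fps_expansion g i \<Lambda>"
      unfolding h_def g_def by (intro has_fps_expansion_cmult_left has_fps_expansion_fps_X)
    show "(\<forall>\<Lambda> t. h i \<Lambda> t = 0) \<or>
      (\<forall>t. t \<noteq> 0 \<longrightarrow> filterlim (\<lambda>\<Lambda>. h i \<Lambda> t) at_infinity at_top) \<and>
      (\<forall>\<Lambda>. (h i \<Lambda> \<longlongrightarrow> 0) (at 0))"
      using c[of i]
    proof
      assume div: "filterlim (c i) at_infinity at_top"
      have "filterlim (\<lambda>\<Lambda>. t * c i \<Lambda>) at_infinity at_top" if "t \<noteq> 0" for t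
        by (rule tendsto_mult_filterlim_at_infinity[OF tendsto_const that div])
      moreover have "((\<lambda>t. c i \<Lambda> * t) \<longlongrightarrow> 0) (at 0)" for \<Lambda>
        by (rule tendsto_mult_right_zero) (rule tendsto_ident_at)
      ultimately show ?thesis
        by (simp add: h_def[abs_def] mult.commute)
    qed (simp add: h_def)
  qed
  moreover have "shifted_integral (b \<Lambda>) P (\<lambda>i. g i \<Lambda>) = exp_integral (b \<Lambda>) (Q \<Lambda>)" for \<Lambda>
    unfolding Q_def
    by (rule shifted_integral_linear)
      (simp_all add: g_def c_def complex_fps_def fps_eq_iff Complex_eq)
  moreover have "\<forall>\<^sub>F \<Lambda> in at_top. shifted_integral_finite (b \<Lambda>) P (\<lambda>i. g i \<Lambda>)"
    using finite
  proof eventually_elim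
    case (elim \<Lambda>)
    then show ?case
      by (intro shifted_integral_finite_linear[where G = "fps_const (a \<Lambda>) * fps_X"])
        (simp_all add: g_def c_def)
  qed
  ultimately have "\<exists>h g. counterterms h g \<and>
      (\<forall>\<^sub>F \<Lambda> in at_top. shifted_integral_finite (b \<Lambda>) P (\<lambda>i. g i \<Lambda>) \<and>
        exp_integral (b \<Lambda>) (Q \<Lambda>) = shifted_integral (b \<Lambda>) P (\<lambda>i. g i \<Lambda>))"
    by (intro exI[of _ h] exI[of _ g]) simp
  then show ?thesis
    unfolding renormalization_def using lim by simp
qed

text \<open>The reciprocal equals \<open>\<rho>\<close> divided by \<open>\<beta> j\<close>, also
  where \<open>\<rho>\<close> vanishes, and for \<Lambda> > 0 the argument of \<open>\<rho>\<close>
  lies in its domain.\<close>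

lemma regularizing_eventually:
  assumes "\<beta> \<in> seq_class 2" "regularizing \<beta> \<rho> r \<kappa>"
  shows "\<forall>\<^sub>F \<Lambda> in at_top. (\<forall>j. 0 \<le> deformed \<beta> \<rho> \<Lambda> j \<and> 1 / deformed \<beta> \<rho> \<Lambda> j \<le> 1 / \<beta> j) \<and>
    summable (\<lambda>j. 1 / deformed \<beta> \<rho> \<Lambda> j)"
proof -
  from assms obtain \<Lambda>\<^sub>0 where "\<Lambda>\<^sub>0 > 0"
    and summ: "\<And>\<Lambda>. \<Lambda> > \<Lambda>\<^sub>0 \<Longrightarrow> summable (\<lambda>j. 1 / deformed \<beta> \<rho> \<Lambda> j)"
    and \<rho>: "\<And>x. 0 \<le> x \<Longrightarrow> 0 \<le> \<rho> x \<and> \<rho> x \<le> 1"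
    by (auto simp: regularizing_def)
  have \<beta>: "0 < \<beta> j" for j
    using assms by (simp add: seq_class_def)
  show ?thesis
    using eventually_gt_at_top[of \<Lambda>\<^sub>0]
  proof eventually_elim
    case (elim \<Lambda>)
    have "0 \<le> \<rho> (sqrt (\<beta> j / \<Lambda>)) \<and> \<rho> (sqrt (\<beta> j / \<Lambda>)) \<le> 1" for j
      using elim \<open>\<Lambda>\<^sub>0 > 0\<close> \<beta>[of j] by (intro \<rho>) simp
    then show ?case
      using summ[OF elim] \<beta> by (simp add: deformed_def divide_right_mono less_imp_le)
  qed
qed

text \<open>The argument of \<open>\<rho>\<close> tends to 0 from the right, and
  \<open>\<rho>\<close> is continuous there with value 1.\<close>

lemma tendsto_inverse_deformed:
  assumes "\<beta> \<in> seq_class 2" "regularizing \<beta> \<rho> r \<kappa>"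
  shows "((\<lambda>\<Lambda>. 1 / deformed \<beta> \<rho> \<Lambda> j) \<longlongrightarrow> 1 / \<beta> j) at_top"
proof -
  have \<beta>: "0 < \<beta> j"
    using assms by (simp add: seq_class_def)
  have "((\<lambda>\<Lambda>. \<beta> j / \<Lambda>) \<longlongrightarrow> 0) at_top"
    by (rule real_tendsto_divide_at_top[OF tendsto_const filterlim_ident])
  then have s: "((\<lambda>\<Lambda>. sqrt (\<beta> j / \<Lambda>)) \<longlongrightarrow> 0) at_top"
    using tendsto_real_sqrt by fastforce
  have nn: "\<forall>\<^sub>F \<Lambda> in at_top. sqrt (\<beta> j / \<Lambda>) \<in> {0..}"
    using eventually_gt_at_top[of 0] by eventually_elim (use \<beta> in simp)
  have "((\<lambda>\<Lambda>. \<rho> (sqrt (\<beta> j / \<Lambda>))) \<longlongrightarrow> \<rho> 0) at_top"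
    using assms(2) nn by (intro continuous_on_tendsto_compose[OF _ s]) (auto simp: regularizing_def)
  then have "((\<lambda>\<Lambda>. \<rho> (sqrt (\<beta> j / \<Lambda>)) / \<beta> j) \<longlongrightarrow> 1 / \<beta> j) at_top"
    using assms(2) \<beta> by (intro tendsto_divide tendsto_const) (auto simp: regularizing_def)
  then show ?thesis
    by (simp add: deformed_def)
qed

text \<open>Dominated convergence with majorant \<open>(1 / \<beta> j) ^ m\<close>. It is summable
  because summable squares force \<open>1 / \<beta> j < 1\<close> eventually, whence higher powers
  lie below the squares.\<close>

lemma power_sums_converge:
  assumes \<beta>: "\<beta> \<in> seq_class 2" and reg: "regularizing \<beta> \<rho> r \<kappa>" and "2 \<le> m"
  shows "((\<lambda>\<Lambda>. \<Sum>j. (1 / deformed \<beta> \<rho> \<Lambda> j) ^ m) \<longlongrightarrow> (\<Sum>j. (1 / \<beta> j) ^ m)) at_top"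
proof -
  have pos: "0 < \<beta> j" for j
    using \<beta> by (simp add: seq_class_def)
  have summ2: "summable (\<lambda>j. (1 / \<beta> j)\<^sup>2)"
    using \<beta> by (simp add: seq_class_def power_one_over)
  then have "(\<lambda>j. (1 / \<beta> j)\<^sup>2) \<longlonglongrightarrow> 0"
    by (rule summable_LIMSEQ_zero)
  then have "\<forall>\<^sub>F j in sequentially. (1 / \<beta> j)\<^sup>2 < 1"
    by (rule order_tendstoD) simp
  then have le_sq: "\<forall>\<^sub>F j in sequentially. (1 / \<beta> j) ^ m \<le> (1 / \<beta> j)\<^sup>2"
  proof eventually_elim
    case (elim j)
    then have "\<bar>1 / \<beta> j\<bar> < 1"
      by (simp only: abs_square_less_1)
    then have "1 / \<beta> j \<le> 1"
      by linarith
    then show ?case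
      using pos[of j] \<open>2 \<le> m\<close> by (intro power_decreasing) auto
  qed
  have "summable (\<lambda>j. (1 / \<beta> j) ^ m)"
    using le_sq pos
    by (intro summable_comparison_test_ev[OF _ summ2]) (auto simp: less_imp_le elim: eventually_mono)
  moreover have "\<forall>\<^sub>F (j, \<Lambda>) in at_top \<times>\<^sub>F at_top.
      norm ((1 / deformed \<beta> \<rho> \<Lambda> j) ^ m) \<le> (1 / \<beta> j) ^ m"
  proof -
    have "\<forall>\<^sub>F \<Lambda> in at_top. \<forall>j. norm ((1 / deformed \<beta> \<rho> \<Lambda> j) ^ m) \<le> (1 / \<beta> j) ^ m"
      using regularizing_eventually[OF \<beta> reg]
      by eventually_elim (auto simp: norm_power intro!: power_mono)
    then have "\<forall>\<^sub>F z in at_top \<times>\<^sub>F at_top. \<forall>j.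
        norm ((1 / deformed \<beta> \<rho> (snd z) j) ^ m) \<le> (1 / \<beta> j) ^ m"
      by (rule eventually_compose_filterlim[OF _ filterlim_snd])
    then show ?thesis
      by (rule eventually_mono) auto
  qed
  moreover have "((\<lambda>\<Lambda>. (1 / deformed \<beta> \<rho> \<Lambda> j) ^ m) \<longlongrightarrow> (1 / \<beta> j) ^ m) at_top" for j
    by (intro tendsto_power tendsto_inverse_deformed[OF \<beta> reg])
  ultimately show ?thesis
    using tannerys_theorem[where a = "\<lambda>j \<Lambda>. (1 / deformed \<beta> \<rho> \<Lambda> j) ^ m"
        and b = "\<lambda>j. (1 / \<beta> j) ^ m" and M = "\<lambda>j. (1 / \<beta> j) ^ m" and F = at_top]
    by simp
qed

lemma renormalized_moments_converge:
  assumes \<beta>: "\<beta> \<in> seq_class 2" and reg: "regularizing \<beta> \<rho> r \<kappa>"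
  shows "\<exists>L. ((\<lambda>\<Lambda>. H (deformed \<beta> \<rho> \<Lambda>)
    ((S1 - [:complex_of_real (r \<Lambda> / 2 + \<theta> / 2):]) ^ k)) \<longlongrightarrow> L) at_top"
proof -
  let ?b = "deformed \<beta> \<rho>"
  define w where "w \<Lambda> = - complex_of_real (r \<Lambda> / 2 + \<theta> / 2)" for \<Lambda>
  define D where "D \<Lambda> = exp_integral (?b \<Lambda>) (S1 + [:w \<Lambda>:])" for \<Lambda>
  define G where "G \<Lambda> = Abs_fps (\<lambda>i. complex_of_real ((\<Sum>j. (1 / ?b \<Lambda> j) ^ Suc i) / 2)) +
    fps_const (w \<Lambda>)" for \<Lambda>
  have ode: "\<forall>\<^sub>F \<Lambda> in at_top. fps_deriv (D \<Lambda>) = D \<Lambda> * G \<Lambda>"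
    using regularizing_eventually[OF \<beta> reg]
  proof eventually_elim
    case (elim \<Lambda>)
    then show ?case
      unfolding D_def G_def by (intro exp_integral_shifted_S1_deriv) auto
  qed
  have initial: "\<forall>\<^sub>F \<Lambda> in at_top. fps_nth (D \<Lambda>) 0 = 1"
    by (simp add: D_def exp_integral_nth_0)
  have lim: "\<exists>L. ((\<lambda>\<Lambda>. fps_nth (G \<Lambda>) n) \<longlongrightarrow> L) at_top" for n
  proof (cases n)
    case 0
    have "((\<lambda>\<Lambda>. (\<Sum>j. 1 / ?b \<Lambda> j) - (r \<Lambda> + \<kappa>)) \<longlongrightarrow> 0) at_top"
      using reg by (simp add: regularizing_def)
    \<comment> \<open>The divergence cancels here: subtracting
      \<open>r \<Lambda> / 2 + \<theta> / 2\<close> leaves the vanishing error of the regularization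
      plus \<open>\<kappa> - \<theta>\<close>, halved.\<close>
    then have "((\<lambda>\<Lambda>. complex_of_real ((((\<Sum>j. 1 / ?b \<Lambda> j) - (r \<Lambda> + \<kappa>)) + (\<kappa> - \<theta>)) / 2)) \<longlongrightarrow>
        complex_of_real ((0 + (\<kappa> - \<theta>)) / 2)) at_top"
      by (intro tendsto_intros) auto
    also have "(\<lambda>\<Lambda>. complex_of_real ((((\<Sum>j. 1 / ?b \<Lambda> j) - (r \<Lambda> + \<kappa>)) + (\<kappa> - \<theta>)) / 2)) =
        (\<lambda>\<Lambda>. fps_nth (G \<Lambda>) n)"
      using 0 by (auto simp: G_def w_def field_simps)
    finally show ?thesis ..
  next
    case (Suc i)
    \<comment> \<open>As \<open>n\<close> is positive, the exponent \<open>Suc n\<close> is at least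
      2 and the constant \<open>w\<close> does not enter.\<close>
    have "((\<lambda>\<Lambda>. complex_of_real ((\<Sum>j. (1 / ?b \<Lambda> j) ^ Suc n) / 2)) \<longlongrightarrow>
        complex_of_real ((\<Sum>j. (1 / \<beta> j) ^ Suc n) / 2)) at_top"
      using Suc by (intro tendsto_of_real tendsto_divide tendsto_const power_sums_converge[OF \<beta> reg]) auto
    then show ?thesis
      using Suc unfolding G_def by (intro exI) simp
  qed
  from fps_deriv_eq_mult_tendsto[OF ode initial lim, of k] obtain L
    where "((\<lambda>\<Lambda>. fps_nth (D \<Lambda>) k) \<longlongrightarrow> L) at_top"
    by blast
  then have "((\<lambda>\<Lambda>. fact k * fps_nth (D \<Lambda>) k) \<longlongrightarrow> fact k * L) at_top"
    by (rule tendsto_mult_left)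
  moreover have "fact k * fps_nth (D \<Lambda>) k =
      H (?b \<Lambda>) ((S1 - [:complex_of_real (r \<Lambda> / 2 + \<theta> / 2):]) ^ k)" for \<Lambda>
    by (simp add: D_def exp_integral_def w_def)
  ultimately show ?thesis
    by auto
qed

theorem theorem3:
  fixes \<beta> :: "nat \<Rightarrow> real" and \<rho> r :: "real \<Rightarrow> real" and \<kappa> \<theta> :: real
  assumes "\<beta> \<in> seq_class 2 - seq_class 1"
    and "regularizing \<beta> \<rho> r \<kappa>"
  shows
    "let b = deformed \<beta> \<rho>;
         T = (\<lambda>\<Lambda>. S1 - [:complex_of_real (r \<Lambda> / 2 + \<theta> / 2):]);
         A = (\<lambda>\<Lambda>. Abs_fps (\<lambda>j. \<i> ^ j / fact j * H (b \<Lambda>) (S1 ^ j)));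
         B = (\<lambda>\<Lambda>. Abs_fps (\<lambda>j. (- 1) ^ j / fact j * H (b \<Lambda>) (S1 ^ (2 * j))));
         A' = (\<lambda>\<Lambda>. Abs_fps (\<lambda>j. \<i> ^ j / fact j * H (b \<Lambda>) (T \<Lambda> ^ j)));
         B' = (\<lambda>\<Lambda>. Abs_fps (\<lambda>j. (- 1) ^ j / fact j * H (b \<Lambda>) (T \<Lambda> ^ (2 * j))))
     in renormalizable b (smult \<i> S1) A \<and> renormalizable b (- (S1 ^ 2)) B \<and>
        renormalization b (smult \<i> S1) A A' \<and> renormalization b (- (S1 ^ 2)) B B' \<and>
        A' = (\<lambda>\<Lambda>. exp_integral (b \<Lambda>) (smult \<i> (T \<Lambda>))) \<and>
        B' = (\<lambda>\<Lambda>. exp_integral (b \<Lambda>) (- (T \<Lambda> ^ 2))) \<and>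
        (\<forall>\<^sub>F \<Lambda> in at_top. \<forall>j. H_finite (b \<Lambda>) (T \<Lambda> ^ j) \<and> H_finite (b \<Lambda>) (T \<Lambda> ^ (2 * j))) \<and>
        (\<forall>j. \<exists>L. ((\<lambda>\<Lambda>. fps_nth (A' \<Lambda>) j) \<longlongrightarrow> L) at_top) \<and>
        (\<forall>j. \<exists>L. ((\<lambda>\<Lambda>. fps_nth (B' \<Lambda>) j) \<longlongrightarrow> L) at_top)"
proof -
  define b where "b = deformed \<beta> \<rho>"
  define c where "c \<Lambda> = r \<Lambda> / 2 + \<theta> / 2" for \<Lambda>
  define T where "T \<Lambda> = S1 - [:complex_of_real (c \<Lambda>):]" for \<Lambda>
  have \<beta>: "\<beta> \<in> seq_class 2"
    using assms(1) by simp
  have moments: "\<exists>L. ((\<lambda>\<Lambda>. H (b \<Lambda>) (T \<Lambda> ^ k)) \<longlongrightarrow> L) at_top" for k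
    using renormalized_moments_converge[OF \<beta> assms(2), of \<theta> k] by (simp only: b_def T_def c_def)
  have wick_fin: "\<forall>\<^sub>F \<Lambda> in at_top. \<forall>k. wick_finite (b \<Lambda>) (replicate k (\<lambda>_. 1))"
    using regularizing_eventually[OF \<beta> assms(2)]
    by eventually_elim (auto simp: b_def intro!: wick_finite_ones)
  have expA: "Abs_fps (\<lambda>j. \<i> ^ j / fact j * H (b \<Lambda>) (P ^ j)) = exp_integral (b \<Lambda>) (smult \<i> P)" for \<Lambda> P
    by (rule exp_integral_smult[symmetric])
  have expB: "Abs_fps (\<lambda>j. (- 1) ^ j / fact j * H (b \<Lambda>) (P ^ (2 * j))) =
      exp_integral (b \<Lambda>) (- (P ^ 2))" for \<Lambda> P
    using exp_integral_smult[of "b \<Lambda>" "- 1" "P ^ 2"] by (simp add: power_mult)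
  have limA: "\<exists>L. ((\<lambda>\<Lambda>. fps_nth (exp_integral (b \<Lambda>) (smult \<i> (T \<Lambda>))) n) \<longlongrightarrow> L) at_top" for n
    unfolding expA[symmetric] fps_nth_Abs_fps
    using moments[of n] by (elim exE) (rule exI, erule tendsto_mult_left)
  have limB: "\<exists>L. ((\<lambda>\<Lambda>. fps_nth (exp_integral (b \<Lambda>) (- (T \<Lambda> ^ 2))) n) \<longlongrightarrow> L) at_top" for n
    unfolding expB[symmetric] fps_nth_Abs_fps
    using moments[of "2 * n"] by (elim exE) (rule exI, erule tendsto_mult_left)
  \<comment> \<open>Since \<open>r\<close> diverges, so do \<open>c\<close> and its square, as
    required of nonzero counterterms.\<close>
  have "filterlim r at_top at_top"
    using assms(2) by (simp add: regularizing_def)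
  then have "filterlim (\<lambda>\<Lambda>. \<theta> / 2 + 1 / 2 * r \<Lambda>) at_top at_top"
    by (intro filterlim_tendsto_add_at_top[OF tendsto_const]
        filterlim_tendsto_pos_mult_at_top[OF tendsto_const]) simp_all
  also have "(\<lambda>\<Lambda>. \<theta> / 2 + 1 / 2 * r \<Lambda>) = c"
    by (simp add: c_def fun_eq_iff)
  finally have c: "filterlim c at_infinity at_top"
    by (rule filterlim_at_top_imp_at_infinity)
  have scale_c: "filterlim (\<lambda>\<Lambda>. d * c \<Lambda>) at_infinity at_top" if "d \<noteq> 0" for d
    by (rule tendsto_mult_filterlim_at_infinity[OF tendsto_const that c])
  have c_sq: "filterlim (\<lambda>\<Lambda>. - (c \<Lambda> * c \<Lambda>)) at_infinity at_top"
    using tendsto_mult_filterlim_at_infinity[OF tendsto_const[of "-1"] _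
      filterlim_at_infinity_times[OF c c]] by simp
  \<comment> \<open>The phase \<open>- c\<close> in the overall factor suffices; the sequence is not
    shifted.\<close>
  have QA: "smult \<i> S1 - smult (of_real 0) S1 + [:Complex 0 (- 1 * c \<Lambda>):] = smult \<i> (T \<Lambda>)" for \<Lambda>
    by (simp add: T_def Complex_eq)
  \<comment> \<open>Expanding the square leaves \<open>2 * c * S1 - c ^ 2\<close> as correction. A
    shift enters the exponent with a minus sign, hence \<open>a = - 2 * c\<close>.\<close>
  have QB: "- (S1 ^ 2) - smult (of_real (- 2 * c \<Lambda>)) S1 + [:Complex (- (c \<Lambda> * c \<Lambda>)) 0:] =
      - (T \<Lambda> ^ 2)" for \<Lambda>
    by (simp add: T_def Complex_eq power2_eq_square)
  have renA: "renormalization b (smult \<i> S1) (\<lambda>\<Lambda>. exp_integral (b \<Lambda>) (smult \<i> S1))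
      (\<lambda>\<Lambda>. exp_integral (b \<Lambda>) (smult \<i> (T \<Lambda>)))"
    by (rule renormalization_linear[of "\<lambda>_. 0" "\<lambda>_. 0" "\<lambda>\<Lambda>. - 1 * c \<Lambda>" b "smult \<i> S1",
          unfolded QA, OF _ wick_fin limA])
      (use scale_c[of "- 1"] in auto)
  have renB: "renormalization b (- (S1 ^ 2)) (\<lambda>\<Lambda>. exp_integral (b \<Lambda>) (- (S1 ^ 2)))
      (\<lambda>\<Lambda>. exp_integral (b \<Lambda>) (- (T \<Lambda> ^ 2)))"
    by (rule renormalization_linear[of "\<lambda>\<Lambda>. - 2 * c \<Lambda>" "\<lambda>\<Lambda>. - (c \<Lambda> * c \<Lambda>)" "\<lambda>_. 0" b
          "- (S1 ^ 2)", unfolded QB, OF _ wick_fin limB])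
      (use scale_c[of "- 2"] c_sq in auto)
  have fin: "\<forall>\<^sub>F \<Lambda> in at_top. \<forall>j. H_finite (b \<Lambda>) (T \<Lambda> ^ j) \<and> H_finite (b \<Lambda>) (T \<Lambda> ^ (2 * j))"
    using wick_fin by eventually_elim (blast intro: H_finite_if_wick_finite)
  show ?thesis
    unfolding Let_def b_def[symmetric] c_def[symmetric] T_def[symmetric] expA expB
    unfolding renormalizable_def
    using renA renB fin limA limB by blast
qed

end
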